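(* Let $\mathcal{C}_F$ be a plane branch with value semigroup $\Gamma_F=\langle v_0,\ldots,v_g\rangle$, characteristic exponents $\beta_0,\ldots,\beta_g$ and canonical system of semiroots $\{F_0=x,F_1,\ldots,F_g,F_{g+1}=F\}$. Let $\omega=H_1\omega_{ij}+dH_2$ with $0\le i<j\le g$, where $\omega_{ij}=v_iF_idF_j-v_jF_jdF_i$, $H_l\in\mathbb{C}\{x\}[y]$ and $\deg_yH_l<\deg_yF_{j+1}=\frac{v_0}{e_j}$ for $l=1,2$, $H_1\ne0$, $H_2\in\langle x,y\rangle$ and $$I(F,H_1)+v_i+v_j<I(F,H_2),$$ and assume that $\omega$ defines a foliation $\mathcal{F}_\omega$. Let $\mathcal{C}_{F_\star}$ be the special separatrix of $\mathcal{F}_\omega$ (the member with $u=c_{\beta_j}$ of the family $\psi_u$ described in the context). Then $$c(\mathcal{C}_F,\mathcal{C}_{F_\star})=\frac{\nu(\omega)-I(F,H_1)-v_i-v_j+\beta_j}{v_0}.$$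
   Context: Branch data. $F\in\mathbb{C}\{x\}[y]$ is an irreducible Weierstrass polynomial with $\deg_yF=\mathrm{mult}(F)=n>1$, $\mathcal{C}_F=\{F=0\}$, with coordinates normalized so that $\mathcal{C}_F$ has a primitive Puiseux parameterization $\varphi(t)=\left(t^{n},\sum_{k\ge\beta_1}c_kt^k\right)$ with $\beta_1>n$, $n\nmid\beta_1$, $c_{\beta_1}\ne0$. Put $\beta_0=e_0=n$, $\beta_j=\min\{k:\ e_{j-1}\nmid k,\ c_k\neq0\}$, $e_j=\gcd(e_{j-1},\beta_j)$, until $e_g=1$; the $\beta_j$ are the characteristic exponents. Put $n_0=1$, $n_i=e_{i-1}/e_i$, and $v_0=n$, $v_1=\beta_1$, $v_i=n_{i-1}v_{i-1}+\beta_i-\beta_{i-1}$ for $2\le i\le g$. The intersection multiplicity is $I(F,G)=\dim_{\mathbb{C}}\mathbb{C}\{x,y\}/\langle F,G\rangle=\mathrm{ord}_tG(\varphi(t))$ ($=\infty$ if $F\mid G$, in particular if $G=0$). The value semigroup $\Gamma_F=\{I(F,G):G\in\mathbb{C}\{x,y\}\}$ is minimally generated by $v_0,\ldots,v_g$. Canonical system of semiroots: $F_0=x$, $F_{g+1}=F$ and, for $1\le i\le g$, $F_i\in\mathbb{C}\{x\}[y]$ is the minimal polynomial over $\mathbb{C}((x))$ of $\sum_{\beta_1\le k<\beta_i}c_kx^{k/n}$ (so $F_1=y$). One has $\deg_yF_i=v_0/e_{i-1}$ for $i\geq 1$ and $I(F,F_i)=v_i$ for $0\le i\le g$. Foliations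 and values. For $\omega=A\,dx+B\,dy$ with $A,B\in\mathbb{C}\{x,y\}$ and $\psi(t)=(x(t),y(t))$, put $\psi^*(\omega)=A(\psi(t))x'(t)+B(\psi(t))y'(t)$. The form $\omega$ defines a foliation $\mathcal{F}_\omega$ when $A(0,0)=B(0,0)=0$ and $\gcd(A,B)=1$; a branch parameterized by $\psi$ is a separatrix of $\mathcal{F}_\omega$ if $\psi^*(\omega)=0$. The value of $\omega$ along $\mathcal{C}_F$ is $\nu(\omega)=\mathrm{ord}_t(\varphi^*(\omega))+1$, with $\nu(\omega)=\infty$ if $\varphi^*(\omega)=0$. Special separatrix. Under the stated hypotheses on $\omega$, $\mathcal{F}_\omega$ admits a family of separatrices, one for each $u\in\mathbb{C}^*$, parameterized by $$\psi_u(t)=\left(t^{\frac{\beta_0}{e_j}},\ \sum_{\beta_1\le l<\beta_j}c_lt^{\frac{l}{e_j}}+ut^{\frac{\beta_j}{e_j}}+\sum_{l>\frac{\beta_j}{e_j}}s_l(u)t^l\right),\qquad s_l(u)\in\mathbb{C}(u).$$ $F_\star\in\mathbb{C}\{x\}[y]$ denotes the irreducible Weierstrass polynomial with $F_\star(\psi_{c_{\beta_j}}(t))=0$, where $c_{\beta_j}$ is the coefficient of $t^{\beta_j}$ in $\varphi(t)$. Contact. For branches $\mathcal{C}_F,\mathcal{C}_G$ with Puiseux parameterizations $(t^{v_0},\phi(t))$ and $(t^{v_0'},\phi'(t))$, $$c(\mathcal{C}_F,\mathcal{C}_G)=\max_{\gamma,\delta}\frac{\mathrm{ord}_t\left(\phi(\gamma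 t^{v_0'})-\phi'(\delta t^{v_0})\right)}{v_0v_0'},$$ over $\gamma,\delta\in\mathbb{C}$ with $\gamma^{v_0}=1=\delta^{v_0'}$ (here $\mathrm{ord}_t(0)=\infty$). *)

theory Defs
  imports "HOL-Analysis.Analysis" "HOL-Computational_Algebra.Computational_Algebra"
begin

unbundle no vec_syntax

section \<open>Convergent power series in one variable\<close>

typedef conv_fps = "{f :: complex fps. fps_conv_radius f > 0}"
  by (rule exI[of _ 0]) simp

setup_lifting type_definition_conv_fps

instantiation conv_fps :: idom
begin

lift_definition zero_conv_fps :: conv_fps is 0 by simp
lift_definition one_conv_fps :: conv_fps is 1 by simp
lift_definition plus_conv_fps :: "conv_fps \<Rightarrow> conv_fps \<Rightarrow> conv_fps" is "(+)"
  using fps_conv_radius_add by (metis less_le_trans min_less_iff_conj)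
lift_definition minus_conv_fps :: "conv_fps \<Rightarrow> conv_fps \<Rightarrow> conv_fps" is "(-)"
  using fps_conv_radius_diff by (metis less_le_trans min_less_iff_conj)
lift_definition uminus_conv_fps :: "conv_fps \<Rightarrow> conv_fps" is uminus by simp
lift_definition times_conv_fps :: "conv_fps \<Rightarrow> conv_fps \<Rightarrow> conv_fps" is "(*)"
  using fps_conv_radius_mult by (metis less_le_trans min_less_iff_conj)

instance
  by standard (transfer, simp add: algebra_simps)+

end

abbreviation to_fps :: "conv_fps \<Rightarrow> complex fps" where
  "to_fps \<equiv> Rep_conv_fps"

lift_definition conv_X :: conv_fps is fps_X by simp

lift_definition conv_deriv :: "conv_fps \<Rightarrow> conv_fps" is fps_deriv
  using fps_conv_radius_deriv less_le_trans by blast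


section \<open>Convergent power series in two variables\<close>

text \<open>
  In a series \<open>f :: complex fps fps\<close> the outer variable is \<open>y\<close> and the inner one is \<open>x\<close>, i.e.
  \<open>f $ j $ i\<close> is the coefficient of \<open>x^i y^j\<close>.
\<close>

definition convergent2 :: "complex fps fps \<Rightarrow> bool" where
  "convergent2 f \<longleftrightarrow>
     (\<exists>r>0. (\<lambda>(i, j). norm (f $ j $ i) * r ^ (i + j)) summable_on (UNIV :: (nat \<times> nat) set))"

lemma convergent2_iff_bounded:
  "convergent2 f \<longleftrightarrow> (\<exists>r>0. \<exists>K. \<forall>i j. norm (f $ j $ i) * r ^ (i + j) \<le> K)"
proof
  assume "convergent2 f"
  then obtain r where r: "r > 0" and
    s: "(\<lambda>(i, j). norm (f $ j $ i) * r ^ (i + j)) summable_on (UNIV :: (nat \<times> nat) set)"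
    unfolding convergent2_def by blast
  let ?h = "\<lambda>(i, j). norm (f $ j $ i) * r ^ (i + j)"
  have "norm (f $ j $ i) * r ^ (i + j) \<le> infsum ?h UNIV" for i j
    using finite_sum_le_infsum[OF s, of "{(i, j)}"] r by auto
  with r show "\<exists>r>0. \<exists>K. \<forall>i j. norm (f $ j $ i) * r ^ (i + j) \<le> K" by blast
next
  assume "\<exists>r>0. \<exists>K. \<forall>i j. norm (f $ j $ i) * r ^ (i + j) \<le> K"
  then obtain r K where r: "r > 0" and K: "\<And>i j. norm (f $ j $ i) * r ^ (i + j) \<le> K" by blast
  have g: "(\<lambda>n::nat. (1/2) ^ n :: real) summable_on UNIV"
    by (intro summable_nonneg_imp_summable_on) (auto intro: summable_geometric)
  have S: "(\<lambda>x::nat \<times> nat. ((1/2) ^ fst x * (1/2) ^ snd x) * K) summable_on UNIV"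
  proof (rule summable_on_cmult_left)
    have "(\<lambda>(i, j). (1/2) ^ i * (1/2) ^ j :: real) summable_on ((UNIV :: nat set) \<times> (UNIV :: nat set))"
      by (rule summable_on_SigmaI[where g = "\<lambda>i. (1/2) ^ i * infsum (\<lambda>n::nat. (1/2) ^ n :: real) UNIV"])
         (auto intro!: has_sum_cmult_right has_sum_infsum g summable_on_cmult_left)
    then show "(\<lambda>x::nat \<times> nat. (1/2) ^ fst x * (1/2) ^ snd x :: real) summable_on UNIV"
      by (simp add: case_prod_unfold)
  qed
  have "(\<lambda>(i, j). norm (f $ j $ i) * (r/2) ^ (i + j)) summable_on (UNIV :: (nat \<times> nat) set)"
  proof (rule summable_on_comparison_test[OF S])
    fix x :: "nat \<times> nat"
    obtain i j where x: "x = (i, j)" by force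
    have "norm (f $ j $ i) * (r/2) ^ (i + j) = (norm (f $ j $ i) * r ^ (i + j)) * (1/2) ^ (i + j)"
      by (simp add: power_divide)
    also have "\<dots> \<le> K * (1/2) ^ (i + j)"
      by (rule mult_right_mono[OF K]) simp
    finally show "(case x of (i, j) \<Rightarrow> norm (f $ j $ i) * (r/2) ^ (i + j))
        \<le> ((1/2) ^ fst x * (1/2) ^ snd x) * K"
      by (simp add: x power_add mult_ac)
    show "0 \<le> (case x of (i, j) \<Rightarrow> norm (f $ j $ i) * (r/2) ^ (i + j))"
      using r by (simp add: x)
  qed
  then show "convergent2 f"
    unfolding convergent2_def using r by (intro exI[of _ "r/2"]) simp
qed

lemma convergent2_bounds:
  assumes "convergent2 f" "convergent2 g"
  obtains r K L where "r > 0" "\<And>i j. norm (f $ j $ i) * r ^ (i + j) \<le> K"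
    "\<And>i j. norm (g $ j $ i) * r ^ (i + j) \<le> L"
proof -
  obtain a K where a: "a > 0" and K: "\<And>i j. norm (f $ j $ i) * a ^ (i + j) \<le> K"
    using assms(1) unfolding convergent2_iff_bounded by blast
  obtain b L where b: "b > 0" and L: "\<And>i j. norm (g $ j $ i) * b ^ (i + j) \<le> L"
    using assms(2) unfolding convergent2_iff_bounded by blast
  have "norm (f $ j $ i) * min a b ^ (i + j) \<le> K" for i j
    by (rule order.trans[OF mult_left_mono K]) (use a b in \<open>auto intro!: power_mono\<close>)
  moreover have "norm (g $ j $ i) * min a b ^ (i + j) \<le> L" for i j
    by (rule order.trans[OF mult_left_mono L]) (use a b in \<open>auto intro!: power_mono\<close>)
  ultimately show thesis using that[of "min a b" K L] a b by simp
qed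

lemma convergent2_0: "convergent2 0"
  unfolding convergent2_iff_bounded by (intro exI[of _ 1]) auto

lemma convergent2_uminus: "convergent2 f \<Longrightarrow> convergent2 (- f)"
  unfolding convergent2_def by simp

lemma convergent2_add:
  assumes "convergent2 f" "convergent2 g"
  shows "convergent2 (f + g)"
proof -
  obtain r K L where r: "r > 0" and K: "\<And>i j. norm (f $ j $ i) * r ^ (i + j) \<le> K"
    and L: "\<And>i j. norm (g $ j $ i) * r ^ (i + j) \<le> L"
    using convergent2_bounds[OF assms] by metis
  have "norm ((f + g) $ j $ i) * r ^ (i + j) \<le> K + L" for i j
  proof -
    have "norm ((f + g) $ j $ i) * r ^ (i + j)
        \<le> (norm (f $ j $ i) + norm (g $ j $ i)) * r ^ (i + j)"
      using r by (intro mult_right_mono) (auto intro: norm_triangle_ineq)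
    also have "\<dots> \<le> K + L" using K[of j i] L[of j i] by (simp add: distrib_right)
    finally show ?thesis .
  qed
  with r show ?thesis unfolding convergent2_iff_bounded by blast
qed

lemma convergent2_diff: "convergent2 f \<Longrightarrow> convergent2 g \<Longrightarrow> convergent2 (f - g)"
  using convergent2_add[of f "- g"] convergent2_uminus[of g] by simp

lemma convergent2_mult:
  assumes "convergent2 f" "convergent2 g"
  shows "convergent2 (f * g)"
proof -
  obtain r K L where r: "r > 0" and K: "\<And>i j. norm (f $ j $ i) * r ^ (i + j) \<le> K"
    and L: "\<And>i j. norm (g $ j $ i) * r ^ (i + j) \<le> L"
    using convergent2_bounds[OF assms] by metis
  have K0: "K \<ge> 0" using order.trans[OF _ K[of 0 0], of 0] by simp
  have L0: "L \<ge> 0" using order.trans[OF _ L[of 0 0], of 0] by simp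
  have "norm ((f * g) $ j $ i) * (r/2) ^ (i + j) \<le> K * L" for i j
  proof -
    have "(f * g) $ j $ i = (\<Sum>b=0..j. \<Sum>a=0..i. f $ b $ a * g $ (j - b) $ (i - a))"
      by (simp add: fps_mult_nth fps_sum_nth)
    then have "norm ((f * g) $ j $ i) * r ^ (i + j)
        \<le> (\<Sum>b=0..j. \<Sum>a=0..i. norm (f $ b $ a * g $ (j - b) $ (i - a))) * r ^ (i + j)"
      using r by (auto intro!: mult_right_mono sum_norm_le)
    also have "\<dots> = (\<Sum>b=0..j. \<Sum>a=0..i.
        (norm (f $ b $ a) * r ^ (a + b)) * (norm (g $ (j - b) $ (i - a)) * r ^ ((i - a) + (j - b))))"
      unfolding sum_distrib_right
    proof (intro sum.cong refl)
      fix b a assume "b \<in> {0..j}" "a \<in> {0..i}"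
      then have "i + j = (a + b) + ((i - a) + (j - b))" by simp
      then have "r ^ (i + j) = r ^ (a + b) * r ^ ((i - a) + (j - b))"
        by (metis power_add)
      then show "norm (f $ b $ a * g $ (j - b) $ (i - a)) * r ^ (i + j) =
        (norm (f $ b $ a) * r ^ (a + b)) * (norm (g $ (j - b) $ (i - a)) * r ^ ((i - a) + (j - b)))"
        by (simp add: norm_mult)
    qed
    also have "\<dots> \<le> (\<Sum>b=0..j. \<Sum>a=0..i. K * L)"
      using r by (intro sum_mono mult_mono K L K0) auto
    also have "\<dots> = real (Suc i) * real (Suc j) * (K * L)" by simp
    also have "\<dots> \<le> 2 ^ i * 2 ^ j * (K * L)"
    proof (intro mult_right_mono mult_mono)
      have *: "real (Suc n) \<le> 2 ^ n" for n
      proof -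
        have "Suc n \<le> 2 ^ n" using less_exp[of n] by linarith
        then have "real (Suc n) \<le> real (2 ^ n)" by (rule of_nat_mono)
        then show ?thesis by simp
      qed
      show "real (Suc i) \<le> 2 ^ i" "real (Suc j) \<le> 2 ^ j" by (rule *)+
    qed (use K0 L0 in auto)
    finally have *: "norm ((f * g) $ j $ i) * r ^ (i + j) \<le> 2 ^ (i + j) * (K * L)"
      by (simp add: power_add)
    have "norm ((f * g) $ j $ i) * (r/2) ^ (i + j)
        = (norm ((f * g) $ j $ i) * r ^ (i + j)) / 2 ^ (i + j)"
      by (simp add: power_divide)
    also have "\<dots> \<le> (2 ^ (i + j) * (K * L)) / 2 ^ (i + j)"
      by (rule divide_right_mono[OF *]) simp
    finally show ?thesis by simp
  qed
  with r show ?thesis unfolding convergent2_iff_bounded by (intro exI[of _ "r/2"]) auto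
qed

lemma convergent2_const:
  assumes "fps_conv_radius f > 0"
  shows "convergent2 (fps_const f)"
proof -
  obtain r where r: "0 < ereal r" "ereal r < fps_conv_radius f"
    using ereal_dense2[OF assms] by auto
  have "summable (\<lambda>n. f $ n * of_real r ^ n)"
    using r by (intro summable_in_conv_radius) (auto simp: fps_conv_radius_def)
  then have "Bseq (\<lambda>n. f $ n * of_real r ^ n)"
    using summable_imp_Bseq by blast
  then obtain K where "K > 0" and K: "\<And>n. norm (f $ n * of_real r ^ n) \<le> K"
    unfolding Bseq_def by blast
  have "norm (fps_const f $ j $ i) * r ^ (i + j) \<le> K" for i j
    using K[of i] r \<open>K > 0\<close> by (cases "j = 0") (auto simp: norm_mult norm_power)
  with r show ?thesis
    unfolding convergent2_iff_bounded by (intro exI[of _ r] conjI exI[of _ K] allI) auto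
qed

lemma convergent2_X: "convergent2 fps_X"
  unfolding convergent2_iff_bounded
  by (intro exI[of _ 1] conjI allI) (auto simp: fps_X_def fps_one_nth)

typedef conv_fps2 = "{f. convergent2 f}"
  using convergent2_0 by blast

setup_lifting type_definition_conv_fps2

instantiation conv_fps2 :: idom
begin

lift_definition zero_conv_fps2 :: conv_fps2 is 0 by (rule convergent2_0)
lift_definition one_conv_fps2 :: conv_fps2 is 1
  using convergent2_const[of 1] by simp
lift_definition plus_conv_fps2 :: "conv_fps2 \<Rightarrow> conv_fps2 \<Rightarrow> conv_fps2" is "(+)"
  by (rule convergent2_add)
lift_definition minus_conv_fps2 :: "conv_fps2 \<Rightarrow> conv_fps2 \<Rightarrow> conv_fps2" is "(-)"
  by (rule convergent2_diff)
lift_definition uminus_conv_fps2 :: "conv_fps2 \<Rightarrow> conv_fps2" is uminus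
  by (rule convergent2_uminus)
lift_definition times_conv_fps2 :: "conv_fps2 \<Rightarrow> conv_fps2 \<Rightarrow> conv_fps2" is "(*)"
  by (rule convergent2_mult)

instance
  by standard (transfer, simp add: algebra_simps)+

end

lift_definition coeff2 :: "conv_fps2 \<Rightarrow> nat \<Rightarrow> nat \<Rightarrow> complex" is "\<lambda>f i j. f $ j $ i" .

text \<open>The inclusion \<open>\<complex>{x}[y] \<subseteq> \<complex>{x,y}\<close>.\<close>

lift_definition of_conv_poly :: "conv_fps poly \<Rightarrow> conv_fps2" is
  "\<lambda>p. Abs_fps (\<lambda>j. to_fps (poly.coeff p j))"
proof -
  fix p :: "conv_fps poly"
  show "convergent2 (Abs_fps (\<lambda>j. to_fps (poly.coeff p j)))"
  proof (induction p)
    case 0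
    have "Abs_fps (\<lambda>j. to_fps (poly.coeff 0 j)) = 0"
      by (simp add: fps_eq_iff zero_conv_fps.rep_eq)
    then show ?case by (simp add: convergent2_0)
  next
    case (pCons a p)
    have "Abs_fps (\<lambda>j. to_fps (poly.coeff (pCons a p) j))
        = fps_const (to_fps a) + fps_X * Abs_fps (\<lambda>j. to_fps (poly.coeff p j))"
      by (rule fps_ext) (auto simp: coeff_pCons split: nat.splits)
    moreover have "convergent2 (fps_const (to_fps a))"
      using Rep_conv_fps[of a] by (intro convergent2_const) simp
    ultimately show ?case
      using pCons.IH by (simp add: convergent2_add convergent2_mult convergent2_X)
  qed
qed

definition mult_at_origin :: "conv_fps2 \<Rightarrow> nat" where
  "mult_at_origin f = (LEAST m. \<exists>i j. i + j = m \<and> coeff2 f i j \<noteq> 0)"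

definition ideal2 :: "conv_fps2 \<Rightarrow> conv_fps2 \<Rightarrow> conv_fps2 set" where
  "ideal2 a b = {p * a + q * b | p q. True}"

abbreviation max_ideal2 :: "conv_fps2 set" where
  "max_ideal2 \<equiv> ideal2 (of_conv_poly [:conv_X:]) (of_conv_poly [:0, 1:])"


section \<open>Parameterized branches\<close>

text \<open>
  A pair \<open>(n, \<eta>)\<close> stands for the parameterization \<open>(t^n, \<eta>(t))\<close>; \<open>eval_param G n \<eta>\<close> is
  \<open>G(t^n, \<eta>(t))\<close>.
\<close>

definition eval_param :: "conv_fps poly \<Rightarrow> nat \<Rightarrow> complex fps \<Rightarrow> complex fps" where
  "eval_param G n \<eta> = poly (map_poly (\<lambda>a. fps_compose (to_fps a) (fps_X ^ n)) G) \<eta>"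

definition ord_t :: "complex fps \<Rightarrow> enat" where
  "ord_t f = (if f = 0 then \<infinity> else enat (subdegree f))"

text \<open>
  The intersection multiplicity \<open>I(F, G) = ord_t G(\<phi>(t))\<close> of \<open>G\<close> with the branch \<open>F\<close> having the
  primitive parameterization \<open>\<phi> = (t^n, c(t))\<close>.
\<close>

definition int_mult :: "nat \<Rightarrow> complex fps \<Rightarrow> conv_fps poly \<Rightarrow> enat" where
  "int_mult n c G = ord_t (eval_param G n c)"

definition weierstrass_poly :: "conv_fps poly \<Rightarrow> bool" where
  "weierstrass_poly F \<longleftrightarrow> lead_coeff F = 1 \<and> (\<forall>k<degree F. to_fps (poly.coeff F k) $ 0 = 0)"

text \<open>
  Primitivity means that \<open>(t^n, \<eta>(t))\<close> is not a series in \<open>t^d\<close> for any \<open>d > 1\<close>.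
\<close>

definition puiseux_param :: "conv_fps poly \<Rightarrow> nat \<Rightarrow> complex fps \<Rightarrow> bool" where
  "puiseux_param F n \<eta> \<longleftrightarrow> n > 0 \<and> fps_conv_radius \<eta> > 0 \<and> \<eta> $ 0 = 0 \<and>
     Gcd (insert n {k. \<eta> $ k \<noteq> 0}) = 1 \<and> eval_param F n \<eta> = 0"

definition normalized_branch :: "conv_fps poly \<Rightarrow> nat \<Rightarrow> complex fps \<Rightarrow> bool" where
  "normalized_branch F n c \<longleftrightarrow>
     irreducible F \<and> weierstrass_poly F \<and> degree F = n \<and> mult_at_origin (of_conv_poly F) = n \<and>
     n > 1 \<and> puiseux_param F n c \<and>
     (\<exists>b>n. \<not> n dvd b \<and> c $ b \<noteq> 0 \<and> (\<forall>k<b. c $ k = 0))"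

text \<open>The integers \<open>e_j\<close>, \<open>\<beta>_j\<close>, \<open>g\<close>, \<open>n_i\<close> and \<open>v_i\<close> of the branch \<open>(t^n, c(t))\<close>.\<close>

primrec char_gcd :: "nat \<Rightarrow> complex fps \<Rightarrow> nat \<Rightarrow> nat" where
  "char_gcd n c 0 = n"
| "char_gcd n c (Suc j) =
     gcd (char_gcd n c j) (LEAST k. \<not> char_gcd n c j dvd k \<and> c $ k \<noteq> 0)"

primrec char_exp :: "nat \<Rightarrow> complex fps \<Rightarrow> nat \<Rightarrow> nat" where
  "char_exp n c 0 = n"
| "char_exp n c (Suc j) = (LEAST k. \<not> char_gcd n c j dvd k \<and> c $ k \<noteq> 0)"

definition genus :: "nat \<Rightarrow> complex fps \<Rightarrow> nat" where
  "genus n c = (LEAST j. char_gcd n c j = 1)"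

primrec char_ratio :: "nat \<Rightarrow> complex fps \<Rightarrow> nat \<Rightarrow> nat" where
  "char_ratio n c 0 = 1"
| "char_ratio n c (Suc i) = char_gcd n c i div char_gcd n c (Suc i)"

fun sg_gen :: "nat \<Rightarrow> complex fps \<Rightarrow> nat \<Rightarrow> nat" where
  "sg_gen n c 0 = n"
| "sg_gen n c (Suc 0) = char_exp n c 1"
| "sg_gen n c (Suc (Suc i)) = char_ratio n c (Suc i) * sg_gen n c (Suc i)
     + char_exp n c (Suc (Suc i)) - char_exp n c (Suc i)"


section \<open>Semiroots\<close>

text \<open>
  \<open>P\<close> is the minimal polynomial over \<open>\<complex>((x))\<close> of \<open>\<sigma>(x^(1/n))\<close>. Here \<open>\<complex>((x))\<close> is regarded as a
  subfield of \<open>\<complex>((t))\<close> via \<open>x = t^n\<close>.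
\<close>

definition eval_laurent :: "complex fls poly \<Rightarrow> nat \<Rightarrow> complex fps \<Rightarrow> complex fls" where
  "eval_laurent q n \<sigma> = poly (map_poly (\<lambda>a. fls_compose_power a n) q) (fps_to_fls \<sigma>)"

definition is_min_poly :: "conv_fps poly \<Rightarrow> nat \<Rightarrow> complex fps \<Rightarrow> bool" where
  "is_min_poly P n \<sigma> \<longleftrightarrow>
     (let p = map_poly (\<lambda>a. fps_to_fls (to_fps a)) P in
        lead_coeff p = 1 \<and> eval_laurent p n \<sigma> = 0 \<and>
        (\<forall>q. q \<noteq> 0 \<and> eval_laurent q n \<sigma> = 0 \<longrightarrow> degree p \<le> degree q))"

definition canonical_semiroots ::
    "conv_fps poly \<Rightarrow> nat \<Rightarrow> complex fps \<Rightarrow> (nat \<Rightarrow> conv_fps poly) \<Rightarrow> bool" where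
  "canonical_semiroots F n c S \<longleftrightarrow>
     S 0 = [:conv_X:] \<and> S (genus n c + 1) = F \<and>
     (\<forall>i\<in>{1..genus n c}. is_min_poly (S i) n
        (\<Sum>k = char_exp n c 1..<char_exp n c i. fps_const (c $ k) * fps_X ^ k))"


section \<open>Differential forms and foliations\<close>

text \<open>The pair \<open>(A, B)\<close> stands for the form \<open>A dx + B dy\<close>; pairs are added componentwise.\<close>

type_synonym form = "conv_fps poly \<times> conv_fps poly"

definition dform :: "conv_fps poly \<Rightarrow> form" where
  "dform G = (map_poly conv_deriv G, pderiv G)"

definition scale_form :: "conv_fps poly \<Rightarrow> form \<Rightarrow> form" (infixr "*\<^sub>f" 75) where
  "H *\<^sub>f \<omega> = (H * fst \<omega>, H * snd \<omega>)"

definition omega_form ::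
    "nat \<Rightarrow> complex fps \<Rightarrow> (nat \<Rightarrow> conv_fps poly) \<Rightarrow> nat \<Rightarrow> nat \<Rightarrow> form" where
  "omega_form n c S i j =
     (of_nat (sg_gen n c i) * S i) *\<^sub>f dform (S j) - (of_nat (sg_gen n c j) * S j) *\<^sub>f dform (S i)"

definition pullback :: "form \<Rightarrow> nat \<Rightarrow> complex fps \<Rightarrow> complex fps" where
  "pullback \<omega> n \<eta> = eval_param (fst \<omega>) n \<eta> * fps_deriv (fps_X ^ n)
     + eval_param (snd \<omega>) n \<eta> * fps_deriv \<eta>"

definition form_value :: "nat \<Rightarrow> complex fps \<Rightarrow> form \<Rightarrow> enat" where
  "form_value n c \<omega> = ord_t (pullback \<omega> n c) + 1"

text \<open>
  The condition \<open>gcd(A, B) = 1\<close> refers to the ring \<open>\<complex>{x,y}\<close>, not to \<open>\<complex>{x}[y]\<close>.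
\<close>

definition defines_foliation :: "form \<Rightarrow> bool" where
  "defines_foliation \<omega> \<longleftrightarrow>
     (let A = of_conv_poly (fst \<omega>); B = of_conv_poly (snd \<omega>) in
        coeff2 A 0 0 = 0 \<and> coeff2 B 0 0 = 0 \<and> (\<forall>D. D dvd A \<longrightarrow> D dvd B \<longrightarrow> D dvd 1))"

text \<open>
  The second component of \<open>\<psi>_u\<close>, the first one being \<open>t^(\<beta>_0/e_j)\<close>. The truncated divisions are
  exact: \<open>e_j\<close> divides \<open>\<beta>_0\<close> and \<open>\<beta>_j\<close>, and also every \<open>l < \<beta>_j\<close> with \<open>c_l \<noteq> 0\<close>.
\<close>

definition psi :: "nat \<Rightarrow> complex fps \<Rightarrow> nat \<Rightarrow> (nat \<Rightarrow> complex \<Rightarrow> complex) \<Rightarrow> complex \<Rightarrow> complex fps"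
  where
  "psi n c j s u =
     (let e = char_gcd n c j; b = char_exp n c j in
        (\<Sum>l = char_exp n c 1..<b. fps_const (c $ l) * fps_X ^ (l div e))
        + fps_const u * fps_X ^ (b div e)
        + Abs_fps (\<lambda>l. if l > b div e then s l u else 0))"

text \<open>
  The family \<open>(\<psi>_u)\<close>, \<open>u \<noteq> 0\<close>, consists of separatrices of the foliation defined by \<open>\<omega>\<close>, and the
  \<open>s_l\<close> are rational functions (without poles in \<open>\<complex>\<^sup>*\<close>, since each \<open>\<psi>_u\<close> is defined).
\<close>

definition separatrix_family ::
    "form \<Rightarrow> nat \<Rightarrow> complex fps \<Rightarrow> nat \<Rightarrow> (nat \<Rightarrow> complex \<Rightarrow> complex) \<Rightarrow> bool" where
  "separatrix_family \<omega> n c j s \<longleftrightarrow>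
     (\<forall>l > char_exp n c j div char_gcd n c j. \<exists>p q :: complex poly.
        \<forall>u. u \<noteq> 0 \<longrightarrow> poly q u \<noteq> 0 \<and> s l u = poly p u / poly q u) \<and>
     (\<forall>u. u \<noteq> 0 \<longrightarrow> fps_conv_radius (psi n c j s u) > 0 \<and>
        pullback \<omega> (n div char_gcd n c j) (psi n c j s u) = 0)"


section \<open>Contact\<close>

definition contact_param :: "nat \<Rightarrow> complex fps \<Rightarrow> nat \<Rightarrow> complex fps \<Rightarrow> ereal" where
  "contact_param n \<phi> m \<eta> =
     Max {ereal_of_enat (ord_t (fps_compose \<phi> (fps_const \<gamma> * fps_X ^ m)
                               - fps_compose \<eta> (fps_const \<delta> * fps_X ^ n))) / ereal (real (n * m))
          | \<gamma> \<delta>. \<gamma> ^ n = 1 \<and> \<delta> ^ m = 1}"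

text \<open>
  The contact of two branches is the common value of \<^const>\<open>contact_param\<close> over all their primitive
  Puiseux parameterizations; these only differ by \<open>t \<mapsto> \<zeta> t\<close> with a root of unity \<open>\<zeta>\<close>, which
  permutes the set in \<^const>\<open>contact_param\<close>.
\<close>

definition contact :: "conv_fps poly \<Rightarrow> conv_fps poly \<Rightarrow> ereal" where
  "contact F G = (THE \<kappa>. \<forall>n \<phi> m \<eta>. puiseux_param F n \<phi> \<longrightarrow> puiseux_param G m \<eta> \<longrightarrow>
     \<kappa> = contact_param n \<phi> m \<eta>)"

end

theory Submission
  imports Defs
begin

text \<open>
  Write the branch as \<open>(t^n, c(t))\<close> and the special separatrix as \<open>(t^N, \<psi>(t))\<close> with
  \<open>N = n/e_j\<close>. After the substitution \<open>t \<mapsto> t^(e_j)\<close> the separatrix is \<open>(t^n, \<eta>(t))\<close>, so that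
  both curves are graphs over the same first coordinate, and \<open>c\<close> and \<open>\<eta>\<close> have the same coefficients
  up to and including the one of \<open>t^(\<beta>_j)\<close>. Put \<open>K = ord_t (c - \<eta>) > \<beta>_j\<close>. The theorem consists
  of two independent computations.

  The contact is \<open>K/n\<close> (\<open>contact_eq\<close>, \<open>contact_param_value\<close>). A primitive parameterization of an
  irreducible polynomial is unique up to rotation by a root of unity, and a rotation that keeps
  agreement up to order \<open>\<beta>_j\<close> must be by a root of unity of order dividing \<open>e_j\<close>; such a rotation
  fixes \<open>\<eta>\<close>, so no rotation does better than the given pair.

  The value is \<open>\<nu>(\<omega>) = I(F,H_1) + v_i + v_j + K - \<beta>_j\<close> (\<open>value_of_separatrix_form\<close>). Since the
  pullback of \<open>\<omega>\<close> along the separatrix is zero, its pullback along the branch is the difference of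
  the two pullbacks, and one has to see how the ingredients change when \<open>c\<close> is replaced by \<open>\<eta>\<close>.
  Each of them is multiplied by a factor \<open>1 + \<epsilon>\<close>. For \<open>F_j\<close> the order of \<open>\<epsilon>\<close> is exactly
  \<open>K - \<beta>_j\<close>, because exactly one conjugate of its root lies at distance \<open>\<beta>_j\<close> from \<open>c\<close> and the
  others are less close (\<open>semiroot_quotient\<close>). For \<open>F_i\<close> with \<open>i < j\<close> the order is
  strictly larger, and for \<open>H_1\<close> and \<open>H_2\<close> it is at least \<open>K - \<beta>_j\<close> (\<open>small_degree\<close>). In the
  difference the derivative of the \<open>\<epsilon>\<close> of \<open>F_j\<close> dominates everything else: the combination
  \<open>v_i F_i dF_j - v_j F_j dF_i\<close> itself has no leading term, which is what the weights \<open>v_i\<close>,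
  \<open>v_j\<close> are for, and \<open>dH_2\<close> contributes only higher terms because \<open>I(F,H_2)\<close> is large
  (\<open>subdegree_pullback_of_close_separatrix\<close>).

  If \<open>K\<close> is infinite, the branch is itself the separatrix and both sides are infinite.
\<close>

section \<open>Substitutions into power series\<close>

abbreviation turn :: "complex \<Rightarrow> complex fps \<Rightarrow> complex fps" where
  "turn \<gamma> f \<equiv> f oo (fps_const \<gamma> * fps_X)"

lemma X_power_nth_0: "m > 0 \<Longrightarrow> (fps_X ^ m :: complex fps) $ 0 = 0"
  by simp

lemma turn_turn: "turn \<gamma> (turn \<delta> f) = turn (\<gamma> * \<delta>) f"
  by (rule fps_ext) (simp only: fps_nth_compose_linear power_mult_distrib mult.assoc)

lemma turn_X_power: "\<gamma> ^ n = 1 \<Longrightarrow> turn \<gamma> (fps_X ^ n) = fps_X ^ n"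
  by (auto simp: fps_eq_iff)

lemma turn_compose_X_power:
  assumes "m > 0"
  shows "turn \<gamma> (f oo fps_X ^ m) = turn (\<gamma> ^ m) f oo fps_X ^ m"
  by (auto simp: fps_eq_iff fps_nth_compose_X_power assms simp flip: power_mult)

lemma compose_X_power_X_power:
  assumes "m > 0" "k > 0"
  shows "f oo fps_X ^ m oo fps_X ^ k = (f :: complex fps) oo fps_X ^ (m * k)"
  using assms
  by (simp add: fps_compose_assoc[symmetric] fps_compose_power[symmetric] mult.commute flip: power_mult)

lemma inj_compose_X_power: "m > 0 \<Longrightarrow> inj (\<lambda>f :: complex fps. f oo fps_X ^ m)"
proof (rule injI)
  fix f g :: "complex fps"
  assume m: "m > 0" and eq: "f oo fps_X ^ m = g oo fps_X ^ m"
  show "f = g"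
  proof (rule fps_ext)
    fix k
    from eq have "(f oo fps_X ^ m) $ (m * k) = (g oo fps_X ^ m) $ (m * k)" by simp
    then show "f $ k = g $ k" using m by (simp add: fps_nth_compose_X_power)
  qed
qed

lemma compose_X_power_eq_iff:
  "m > 0 \<Longrightarrow> f oo fps_X ^ m = g oo fps_X ^ m \<longleftrightarrow> f = (g :: complex fps)"
  using inj_compose_X_power[of m] by (auto dest: injD)

text \<open>
  In this form convergence depends only on the absolute values of the coefficients, so it is
  visibly stable under rotation and under \<open>t^m \<mapsto> t\<close>.
\<close>

lemma fps_conv_radius_pos_iff_bounded:
  fixes f :: "complex fps"
  shows "fps_conv_radius f > 0 \<longleftrightarrow> (\<exists>r>0. \<exists>K. \<forall>k. norm (f $ k) * r ^ k \<le> K)"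
proof
  assume "fps_conv_radius f > 0"
  then obtain r where r: "0 < ereal r" "ereal r < fps_conv_radius f"
    using ereal_dense2 by blast
  have "summable (\<lambda>k. f $ k * of_real r ^ k)"
    using r by (intro summable_in_conv_radius) (auto simp: fps_conv_radius_def)
  then obtain K where "\<And>k. norm (f $ k * of_real r ^ k) \<le> K"
    using summable_imp_Bseq unfolding Bseq_def by blast
  with r show "\<exists>r>0. \<exists>K. \<forall>k. norm (f $ k) * r ^ k \<le> K"
    by (intro exI[of _ r]) (auto simp: norm_mult norm_power)
next
  assume "\<exists>r>0. \<exists>K. \<forall>k. norm (f $ k) * r ^ k \<le> K"
  then obtain r K where r: "r > 0" and K: "\<And>k. norm (f $ k) * r ^ k \<le> K" by blast
  have "summable (\<lambda>k. f $ k * of_real (r / 2) ^ k)"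
  proof (rule summable_comparison_test')
    show "summable (\<lambda>k. K * (1 / 2) ^ k)"
      by (intro summable_mult summable_geometric) auto
    fix k :: nat
    have "norm (f $ k * of_real (r / 2) ^ k) = (norm (f $ k) * r ^ k) * (1 / 2) ^ k"
      using r by (simp add: norm_mult norm_power norm_divide power_divide)
    also have "\<dots> \<le> K * (1 / 2) ^ k"
      by (rule mult_right_mono[OF K]) simp
    finally show "norm (f $ k * of_real (r / 2) ^ k) \<le> K * (1 / 2) ^ k" .
  qed
  from conv_radius_geI[OF this] have "fps_conv_radius f \<ge> ereal (r / 2)"
    using r by (simp add: fps_conv_radius_def)
  moreover have "ereal (r / 2) > 0" using r by simp
  ultimately show "fps_conv_radius f > 0" by (rule less_le_trans[rotated])
qed

lemma fps_conv_radius_turn_pos: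
  assumes "norm \<gamma> = 1" "fps_conv_radius f > 0"
  shows "fps_conv_radius (turn \<gamma> f) > 0"
  using assms unfolding fps_conv_radius_pos_iff_bounded
  by (simp add: norm_mult norm_power)

lemma fps_conv_radius_compose_X_power_posD:
  fixes f :: "complex fps"
  assumes "m > 0" "fps_conv_radius (f oo fps_X ^ m) > 0"
  shows "fps_conv_radius f > 0"
proof -
  obtain r K where r: "r > 0" and K: "\<And>k. norm ((f oo fps_X ^ m) $ k) * r ^ k \<le> K"
    using assms(2) unfolding fps_conv_radius_pos_iff_bounded by blast
  have "norm (f $ k) * (r ^ m) ^ k \<le> K" for k
    using K[of "m * k"] assms(1) by (simp add: fps_nth_compose_X_power power_mult)
  with r show ?thesis
    unfolding fps_conv_radius_pos_iff_bounded by (intro exI[of _ "r ^ m"]) auto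
qed


section \<open>Substituting a parameterization into a polynomial\<close>

lemma map_poly_add_hom:
  assumes "f 0 = 0" "\<And>a b. f (a + b) = f a + f b"
  shows "map_poly f (p + q) = map_poly f p + map_poly f q"
  by (intro poly_eqI) (simp add: coeff_map_poly assms)

lemma map_poly_mult_hom:
  fixes f :: "'a :: comm_ring_1 \<Rightarrow> 'b :: comm_ring_1"
  assumes "f 0 = 0" "\<And>a b. f (a + b) = f a + f b" "\<And>a b. f (a * b) = f a * f b"
  shows "map_poly f (p * q) = map_poly f p * map_poly f q"
proof (induction p)
  case (pCons a p)
  then show ?case
    by (simp add: map_poly_add_hom map_poly_smult map_poly_pCons assms)
qed simp

text \<open>
  The coefficients of \<open>G\<close>, series in \<open>x\<close>, are rewritten as series in \<open>t\<close> via \<open>x = t^n\<close>. Over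
  \<open>\<complex>[[t]]\<close> the parameterizations of the curve \<open>G = 0\<close> with first coordinate \<open>t^n\<close> are just the
  roots of this polynomial, so roots can be counted by degree.
\<close>

definition base_change :: "nat \<Rightarrow> conv_fps poly \<Rightarrow> complex fps poly" where
  "base_change n G = map_poly (\<lambda>a. to_fps a oo fps_X ^ n) G"

lemma eval_param_base_change: "eval_param G n \<eta> = poly (base_change n G) \<eta>"
  by (simp add: eval_param_def base_change_def)

lemma to_fps_simps [simp]:
  "to_fps 0 = 0" "to_fps 1 = 1" "to_fps (a + b) = to_fps a + to_fps b"
  "to_fps (a - b) = to_fps a - to_fps b" "to_fps (a * b) = to_fps a * to_fps b"
  "to_fps (- a) = - to_fps a"
  by (simp_all add: zero_conv_fps.rep_eq one_conv_fps.rep_eq plus_conv_fps.rep_eq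
      minus_conv_fps.rep_eq times_conv_fps.rep_eq uminus_conv_fps.rep_eq)

lemma to_fps_eq_iff [simp]: "to_fps a = to_fps b \<longleftrightarrow> a = b"
  by (rule Rep_conv_fps_inject)

lemma to_fps_eq_0_iff [simp]: "to_fps a = 0 \<longleftrightarrow> a = 0"
  using to_fps_eq_iff[of a 0] by simp

context
  fixes n :: nat
  assumes n: "n > 0"
begin

lemma coeff_base_change: "poly.coeff (base_change n G) k = to_fps (poly.coeff G k) oo fps_X ^ n"
  by (simp add: base_change_def coeff_map_poly)

lemma base_change_add: "base_change n (G + H) = base_change n G + base_change n H"
  by (simp add: base_change_def map_poly_add_hom fps_compose_add_distrib)

lemma base_change_mult: "base_change n (G * H) = base_change n G * base_change n H"
  unfolding base_change_def using n
  by (intro map_poly_mult_hom) (auto simp: fps_compose_add_distrib fps_compose_mult_distrib)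

lemma compose_X_power_eq_0_iff: "to_fps a oo fps_X ^ n = 0 \<longleftrightarrow> a = 0"
  using compose_X_power_eq_iff[OF n, of "to_fps a" 0] by simp

lemma degree_base_change: "degree (base_change n G) = degree G"
  unfolding base_change_def by (rule degree_map_poly) (simp add: compose_X_power_eq_0_iff)

lemma base_change_eq_0_iff: "base_change n G = 0 \<longleftrightarrow> G = 0"
  by (simp add: poly_eq_iff coeff_base_change compose_X_power_eq_0_iff)

lemma eval_param_add: "eval_param (G + H) n \<eta> = eval_param G n \<eta> + eval_param H n \<eta>"
  by (simp add: eval_param_base_change base_change_add)

lemma eval_param_mult: "eval_param (G * H) n \<eta> = eval_param G n \<eta> * eval_param H n \<eta>"
  by (simp add: eval_param_base_change base_change_mult)

lemma eval_param_pCons: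
  "eval_param (pCons a G) n \<eta> = (to_fps a oo fps_X ^ n) + \<eta> * eval_param G n \<eta>"
  by (simp add: eval_param_def map_poly_pCons)

lemma eval_param_diff: "eval_param (G - H) n \<eta> = eval_param G n \<eta> - eval_param H n \<eta>"
  using eval_param_add[of "G - H" H \<eta>] by simp

text \<open>
  Reparameterization by \<open>t \<mapsto> u(t)\<close>, the common source of \<open>eval_param_turn\<close> and
  \<open>eval_param_compose_X_power\<close>.
\<close>

lemma eval_param_compose:
  assumes "u $ 0 = 0"
  shows "eval_param G n \<eta> oo u = poly (map_poly (\<lambda>a. to_fps a oo (fps_X ^ n oo u)) G) (\<eta> oo u)"
proof (induction G)
  case (pCons a G)
  then show ?case using assms n
    by (simp add: eval_param_pCons map_poly_pCons fps_compose_add_distrib fps_compose_mult_distrib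
        fps_compose_assoc)
qed (simp add: eval_param_def)

lemma eval_param_turn:
  assumes "\<gamma> ^ n = 1"
  shows "eval_param G n (turn \<gamma> \<eta>) = turn \<gamma> (eval_param G n \<eta>)"
  using eval_param_compose[of "fps_const \<gamma> * fps_X" G \<eta>] turn_X_power[OF assms]
  by (simp add: eval_param_def)

lemma eval_param_compose_X_power:
  assumes "m > 0"
  shows "eval_param G (n * m) (\<eta> oo fps_X ^ m) = eval_param G n \<eta> oo fps_X ^ m"
proof -
  have "(fps_X :: complex fps) ^ n oo fps_X ^ m = fps_X ^ (n * m)"
    using assms by (simp add: fps_compose_power[symmetric] mult.commute flip: power_mult)
  then show ?thesis
    using eval_param_compose[of "fps_X ^ m" G \<eta>] assms by (simp add: eval_param_def)
qed

lemma pullback_dform: "pullback (dform G) n \<eta> = fps_deriv (eval_param G n \<eta>)"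
proof (induction G)
  case 0
  then show ?case by (simp add: pullback_def dform_def eval_param_def)
next
  case (pCons a G)
  have "to_fps (conv_deriv b) = fps_deriv (to_fps b)" for b
    by (rule conv_deriv.rep_eq)
  moreover from this[of 0] have "conv_deriv 0 = 0"
    by (simp flip: to_fps_eq_0_iff)
  moreover have "fps_deriv (to_fps a oo fps_X ^ n)
      = (fps_deriv (to_fps a) oo fps_X ^ n) * fps_deriv (fps_X ^ n)"
    using n by (intro fps_compose_deriv) simp
  ultimately have "pullback (dform (pCons a G)) n \<eta>
      = fps_deriv (to_fps a oo fps_X ^ n) + \<eta> * pullback (dform G) n \<eta> + eval_param G n \<eta> * fps_deriv \<eta>"
    unfolding pullback_def dform_def
    by (simp add: map_poly_pCons pderiv_pCons eval_param_add eval_param_pCons del: fps_deriv_power)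
      (simp add: algebra_simps del: fps_deriv_power)
  then show ?case
    by (simp add: pCons.IH eval_param_pCons)
qed

lemma pullback_scale: "pullback (H *\<^sub>f \<omega>) n \<eta> = eval_param H n \<eta> * pullback \<omega> n \<eta>"
  by (simp add: pullback_def scale_form_def eval_param_mult algebra_simps)

lemma pullback_add: "pullback (\<omega> + \<omega>') n \<eta> = pullback \<omega> n \<eta> + pullback \<omega>' n \<eta>"
  by (simp add: pullback_def eval_param_add algebra_simps)

lemma pullback_diff: "pullback (\<omega> - \<omega>') n \<eta> = pullback \<omega> n \<eta> - pullback \<omega>' n \<eta>"
  by (simp add: pullback_def eval_param_diff algebra_simps)

lemma pullback_compose_X_power:
  assumes "m > 0"
  shows "pullback \<omega> (n * m) (\<eta> oo fps_X ^ m) = (pullback \<omega> n \<eta> oo fps_X ^ m) * fps_deriv (fps_X ^ m)"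
proof -
  have X: "(fps_X :: complex fps) ^ (n * m) = fps_X ^ n oo fps_X ^ m"
    using assms by (simp add: fps_compose_power[symmetric] mult.commute flip: power_mult)
  show ?thesis using assms
    by (simp only: pullback_def eval_param_compose_X_power X fps_compose_deriv[OF X_power_nth_0]
        fps_compose_add_distrib fps_compose_mult_distrib[OF X_power_nth_0] distrib_right mult.assoc)
qed

lemma eval_param_of_nat: "eval_param (of_nat k) n \<eta> = of_nat k"
proof (induction k)
  case (Suc k)
  have "eval_param 1 n \<eta> = 1"
    by (simp add: one_pCons eval_param_pCons) (simp add: eval_param_def)
  with Suc show ?case by (simp add: eval_param_add)
qed (simp add: eval_param_def)

lemma pullback_omega_form:
  "pullback (omega_form m c S i j) n \<eta> =
     of_nat (sg_gen m c i) * eval_param (S i) n \<eta> * fps_deriv (eval_param (S j) n \<eta>)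
     - of_nat (sg_gen m c j) * eval_param (S j) n \<eta> * fps_deriv (eval_param (S i) n \<eta>)"
  by (simp add: omega_form_def pullback_diff pullback_scale pullback_dform eval_param_mult
      eval_param_of_nat)

end


section \<open>Roots of unity and conjugates\<close>

abbreviation roots_of_unity :: "nat \<Rightarrow> complex set" where
  "roots_of_unity n \<equiv> {\<gamma>. \<gamma> ^ n = 1}"

lemma root_of_unity_gcd:
  fixes \<gamma> :: complex
  assumes "n > 0" "\<gamma> ^ n = 1" "\<gamma> ^ k = 1"
  shows "\<gamma> ^ gcd n k = 1"
proof -
  obtain x y where "n * x = k * y + gcd n k"
    using bezout_nat[of n k] assms(1) by auto
  then have "\<gamma> ^ (n * x) = \<gamma> ^ (k * y) * \<gamma> ^ gcd n k"
    by (simp add: power_add)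
  then show ?thesis using assms by (simp add: power_mult)
qed

lemma root_of_unity_dvd: "(\<gamma> :: complex) ^ d = 1 \<Longrightarrow> d dvd k \<Longrightarrow> \<gamma> ^ k = 1"
  by (auto simp: power_mult elim!: dvdE)

text \<open>
  The exponents \<open>k\<close> with \<open>\<gamma>^k = 1\<close> are the multiples of the order of \<open>\<gamma>\<close>; since \<open>A\<close> may be
  infinite, the pairwise \<open>root_of_unity_gcd\<close> is not enough and the order is used instead.
\<close>

lemma root_of_unity_Gcd:
  fixes \<gamma> :: complex
  assumes n: "n > 0" "\<gamma> ^ n = 1" and A: "\<And>k. k \<in> A \<Longrightarrow> \<gamma> ^ k = 1"
  shows "\<gamma> ^ Gcd (insert n A) = 1"
proof -
  define d where "d = (LEAST d. d > 0 \<and> \<gamma> ^ d = 1)"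
  have d: "d > 0" "\<gamma> ^ d = 1"
    using LeastI[of "\<lambda>d. d > 0 \<and> \<gamma> ^ d = 1" n] n unfolding d_def by auto
  have "d dvd k" if "\<gamma> ^ k = 1" for k
  proof -
    have "\<gamma> ^ gcd d k = 1" "gcd d k > 0"
      using root_of_unity_gcd[OF d that] d by auto
    then have "d \<le> gcd d k"
      unfolding d_def by (intro Least_le) simp
    then have "gcd d k = d"
      using d by (simp add: gcd_le1_nat le_antisym)
    then show ?thesis by (metis gcd_dvd2)
  qed
  then have "d dvd Gcd (insert n A)"
    using n A by (intro Gcd_greatest) auto
  with d show ?thesis by (auto intro: root_of_unity_dvd)
qed

text \<open>
  Otherwise all \<open>n\<close> roots would be among the \<open>gcd n k < n\<close> roots of unity of order dividing
  \<open>gcd n k\<close>.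
\<close>

lemma dvd_if_all_roots_of_unity:
  assumes "n > 0" and "\<And>\<gamma> :: complex. \<gamma> ^ n = 1 \<Longrightarrow> \<gamma> ^ k = 1"
  shows "n dvd k"
proof -
  have "roots_of_unity n \<subseteq> roots_of_unity (gcd n k)"
    using root_of_unity_gcd assms by blast
  then have "card (roots_of_unity n) \<le> card (roots_of_unity (gcd n k))"
    using assms(1) by (intro card_mono finite_roots_unity) (auto simp: Suc_le_eq)
  then have "n \<le> gcd n k"
    using assms(1) by (simp add: card_roots_unity_eq)
  then have "gcd n k = n"
    using assms(1) by (simp add: gcd_le1_nat le_antisym)
  then show ?thesis by (metis gcd_dvd2)
qed

lemma finite_roots_of_unity: "n > 0 \<Longrightarrow> finite (roots_of_unity n)"
  by (simp add: finite_roots_unity)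

lemma root_of_unity_nonzero: "n > 0 \<Longrightarrow> (\<gamma> :: complex) ^ n = 1 \<Longrightarrow> \<gamma> \<noteq> 0"
  by (auto simp: zero_power)

lemma norm_root_of_unity: "n > 0 \<Longrightarrow> (\<gamma> :: complex) ^ n = 1 \<Longrightarrow> norm \<gamma> = 1"
  using power_eq_1_iff[of \<gamma> n] by simp

lemma turn_eq_iff: "turn \<gamma> f = f \<longleftrightarrow> (\<forall>k. f $ k \<noteq> 0 \<longrightarrow> \<gamma> ^ k = 1)"
  by (auto simp: fps_eq_iff)

text \<open>
  The Galois conjugates of the Puiseux series \<open>\<sigma>(x^(1/n))\<close> over \<open>\<complex>((x))\<close>. This is a set, so
  coinciding rotations of \<open>\<sigma>\<close> are counted once.
\<close>

definition conjugates :: "nat \<Rightarrow> complex fps \<Rightarrow> complex fps set" where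
  "conjugates n \<sigma> = (\<lambda>\<gamma>. turn \<gamma> \<sigma>) ` roots_of_unity n"

lemma finite_conjugates: "n > 0 \<Longrightarrow> finite (conjugates n \<sigma>)"
  by (simp add: conjugates_def finite_roots_of_unity)

lemma self_in_conjugates: "\<sigma> \<in> conjugates n \<sigma>"
  unfolding conjugates_def by (rule image_eqI[of _ _ 1]) auto

lemma turn_image_conjugates:
  assumes n: "n > 0" "\<delta> ^ n = 1"
  shows "turn \<delta> ` conjugates n \<sigma> = conjugates n \<sigma>"
proof
  show "turn \<delta> ` conjugates n \<sigma> \<subseteq> conjugates n \<sigma>"
    using n by (auto simp: conjugates_def turn_turn power_mult_distrib)
  show "conjugates n \<sigma> \<subseteq> turn \<delta> ` conjugates n \<sigma>"
  proof
    fix \<rho> assume "\<rho> \<in> conjugates n \<sigma>"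
    then obtain \<gamma> where \<gamma>: "\<gamma> ^ n = 1" "\<rho> = turn \<gamma> \<sigma>" by (auto simp: conjugates_def)
    have "\<delta> \<noteq> 0" using root_of_unity_nonzero n by blast
    then have "\<rho> = turn \<delta> (turn (\<gamma> / \<delta>) \<sigma>)" using \<gamma> by (simp add: turn_turn)
    moreover have "(\<gamma> / \<delta>) ^ n = 1" using \<gamma> n by (simp add: power_divide)
    ultimately show "\<rho> \<in> turn \<delta> ` conjugates n \<sigma>" by (auto simp: conjugates_def)
  qed
qed

text \<open>
  Orbit counting: each conjugate arises from exactly \<open>e\<close> roots of unity, a coset of the stabilizer.
  Sums over all roots of unity are easier to compare for different \<open>\<sigma>\<close> than sums over the
  conjugates, which form sets of different sizes.
\<close>

lemma sum_conjugates:
  fixes f :: "complex fps \<Rightarrow> nat"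
  assumes n: "n > 0" and e: "e dvd n"
    and stab: "\<And>\<gamma>. \<gamma> ^ n = 1 \<Longrightarrow> turn \<gamma> \<sigma> = \<sigma> \<longleftrightarrow> \<gamma> ^ e = 1"
  shows "(\<Sum>\<gamma>\<in>roots_of_unity n. f (turn \<gamma> \<sigma>)) = e * (\<Sum>\<rho>\<in>conjugates n \<sigma>. f \<rho>)"
proof -
  have e0: "e > 0" using n e by (auto intro: Nat.gr0I)
  have fiber: "card {\<gamma> \<in> roots_of_unity n. turn \<gamma> \<sigma> = \<rho>} = e" if \<rho>: "\<rho> \<in> conjugates n \<sigma>" for \<rho>
  proof -
    obtain \<delta> where \<delta>: "\<delta> ^ n = 1" "\<rho> = turn \<delta> \<sigma>"
      using \<rho> by (auto simp: conjugates_def)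
    have d0: "\<delta> \<noteq> 0" using root_of_unity_nonzero n \<delta> by blast
    have "bij_betw (\<lambda>\<gamma>. \<delta> * \<gamma>) (roots_of_unity e) {\<gamma> \<in> roots_of_unity n. turn \<gamma> \<sigma> = \<rho>}"
    proof (rule bij_betwI[where g = "\<lambda>\<gamma>. \<gamma> / \<delta>"])
      show "(\<lambda>\<gamma>. \<delta> * \<gamma>) \<in> roots_of_unity e \<rightarrow> {\<gamma> \<in> roots_of_unity n. turn \<gamma> \<sigma> = \<rho>}"
      proof
        fix \<gamma> assume "\<gamma> \<in> roots_of_unity e"
        then have 1: "\<gamma> ^ e = 1" "\<gamma> ^ n = 1" using root_of_unity_dvd e by auto
        then have "turn (\<delta> * \<gamma>) \<sigma> = turn \<delta> (turn \<gamma> \<sigma>)" by (simp add: turn_turn)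
        also have "turn \<gamma> \<sigma> = \<sigma>" using stab 1 by simp
        finally show "\<delta> * \<gamma> \<in> {\<gamma> \<in> roots_of_unity n. turn \<gamma> \<sigma> = \<rho>}"
          using 1 \<delta> by (simp add: power_mult_distrib)
      qed
      show "(\<lambda>\<gamma>. \<gamma> / \<delta>) \<in> {\<gamma> \<in> roots_of_unity n. turn \<gamma> \<sigma> = \<rho>} \<rightarrow> roots_of_unity e"
      proof
        fix \<gamma> assume "\<gamma> \<in> {\<gamma> \<in> roots_of_unity n. turn \<gamma> \<sigma> = \<rho>}"
        then have 1: "\<gamma> ^ n = 1" "turn \<gamma> \<sigma> = turn \<delta> \<sigma>" using \<delta> by auto
        have "turn (\<gamma> / \<delta>) \<sigma> = turn (1 / \<delta>) (turn \<gamma> \<sigma>)" by (simp add: turn_turn)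
        also have "\<dots> = \<sigma>" using d0 unfolding 1(2) turn_turn by simp
        finally show "\<gamma> / \<delta> \<in> roots_of_unity e"
          using stab[of "\<gamma> / \<delta>"] 1 \<delta> by (simp add: power_divide)
      qed
    qed (use d0 in auto)
    from bij_betw_same_card[OF this] show ?thesis by (simp only: card_roots_unity_eq[OF e0])
  qed
  have "(\<Sum>\<gamma>\<in>roots_of_unity n. f (turn \<gamma> \<sigma>))
      = (\<Sum>\<rho>\<in>conjugates n \<sigma>. \<Sum>\<gamma>\<in>{\<gamma> \<in> roots_of_unity n. turn \<gamma> \<sigma> = \<rho>}. f (turn \<gamma> \<sigma>))"
    unfolding conjugates_def by (rule sum.image_gen) (rule finite_roots_of_unity[OF n])
  also have "\<dots> = (\<Sum>\<rho>\<in>conjugates n \<sigma>. e * f \<rho>)"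
  proof (rule sum.cong[OF refl])
    fix \<rho> assume \<rho>: "\<rho> \<in> conjugates n \<sigma>"
    have "(\<Sum>\<gamma>\<in>{\<gamma> \<in> roots_of_unity n. turn \<gamma> \<sigma> = \<rho>}. f (turn \<gamma> \<sigma>))
        = (\<Sum>\<gamma>\<in>{\<gamma> \<in> roots_of_unity n. turn \<gamma> \<sigma> = \<rho>}. f \<rho>)"
      by (intro sum.cong) auto
    then show "(\<Sum>\<gamma>\<in>{\<gamma> \<in> roots_of_unity n. turn \<gamma> \<sigma> = \<rho>}. f (turn \<gamma> \<sigma>)) = e * f \<rho>"
      by (simp only: sum_constant fiber[OF \<rho>] of_nat_id)
  qed
  finally show ?thesis by (simp add: sum_distrib_left)
qed

lemma card_conjugates:
  assumes "n > 0" "e dvd n" "\<And>\<gamma>. \<gamma> ^ n = 1 \<Longrightarrow> turn \<gamma> \<sigma> = \<sigma> \<longleftrightarrow> \<gamma> ^ e = 1"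
  shows "card (conjugates n \<sigma>) = n div e"
proof -
  have "n = e * card (conjugates n \<sigma>)"
    using sum_conjugates[OF assms, of "\<lambda>_. 1"] assms(1) by (simp add: card_roots_unity_eq)
  then have "n div e = e * card (conjugates n \<sigma>) div e" by simp
  then show ?thesis using assms(1,2) by (cases "e = 0") auto
qed

lemma primitive_turn_eq_iff:
  assumes "n > 0" "Gcd (insert n {k. \<sigma> $ k \<noteq> 0}) = 1" "\<gamma> ^ n = 1"
  shows "turn \<gamma> \<sigma> = \<sigma> \<longleftrightarrow> \<gamma> ^ 1 = 1"
  using root_of_unity_Gcd[OF assms(1,3), of "{k. \<sigma> $ k \<noteq> 0}"] assms(2)
  by (auto simp: turn_eq_iff)


section \<open>The polynomial with a given full set of conjugate roots\<close>

definition conj_poly :: "nat \<Rightarrow> complex fps \<Rightarrow> complex fps poly" where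
  "conj_poly n \<sigma> = (\<Prod>\<rho>\<in>conjugates n \<sigma>. [:- \<rho>, 1:])"

lemma poly_conj_poly: "poly (conj_poly n \<sigma>) \<eta> = (\<Prod>\<rho>\<in>conjugates n \<sigma>. \<eta> - \<rho>)"
  by (simp add: conj_poly_def poly_prod)

lemma monic_conj_poly: "lead_coeff (conj_poly n \<sigma>) = 1"
  by (simp add: conj_poly_def lead_coeff_prod)

lemma degree_conj_poly: "degree (conj_poly n \<sigma>) = card (conjugates n \<sigma>)"
  by (simp add: conj_poly_def degree_prod_sum_eq)

lemma turn_coeff_conj_poly:
  assumes n: "n > 0" and \<delta>: "\<delta> ^ n = 1"
  shows "turn \<delta> (poly.coeff (conj_poly n \<sigma>) k) = poly.coeff (conj_poly n \<sigma>) k"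
proof -
  have X: "(fps_const \<delta> * fps_X) $ 0 = 0" by simp
  have hom: "map_poly (turn \<delta>) (p * q) = map_poly (turn \<delta>) p * map_poly (turn \<delta>) q" for p q
    by (rule map_poly_mult_hom)
      (auto simp: fps_compose_add_distrib fps_compose_mult_distrib[OF X])
  have "map_poly (turn \<delta>) (\<Prod>\<rho>\<in>R. [:- \<rho>, 1:]) = (\<Prod>\<rho>\<in>R. [:- turn \<delta> \<rho>, 1:])" for R
  proof (induction R rule: infinite_finite_induct)
    case (insert \<rho> R)
    show ?case
      unfolding prod.insert[OF insert.hyps] hom insert.IH by (simp add: map_poly_pCons fps_compose_uminus)
  qed simp_all
  then have "map_poly (turn \<delta>) (conj_poly n \<sigma>) = (\<Prod>\<rho>\<in>conjugates n \<sigma>. [:- turn \<delta> \<rho>, 1:])"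
    by (simp add: conj_poly_def)
  also have "\<dots> = (\<Prod>\<rho>\<in>turn \<delta> ` conjugates n \<sigma>. [:- \<rho>, 1:])"
  proof (rule prod.reindex_cong[symmetric, OF _ refl refl, THEN sym, THEN sym])
    have "card (turn \<delta> ` conjugates n \<sigma>) = card (conjugates n \<sigma>)"
      by (simp add: turn_image_conjugates n \<delta>)
    then show "inj_on (turn \<delta>) (conjugates n \<sigma>)"
      by (rule eq_card_imp_inj_on[OF finite_conjugates[OF n]])
  qed
  also have "\<dots> = conj_poly n \<sigma>"
    by (simp add: conj_poly_def turn_image_conjugates n \<delta>)
  finally have "poly.coeff (map_poly (turn \<delta>) (conj_poly n \<sigma>)) k = poly.coeff (conj_poly n \<sigma>) k"
    by simp
  then show ?thesis by (simp add: coeff_map_poly)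
qed

text \<open>
  The coefficients of the product are invariant under all rotations by \<open>n\<close>-th roots of unity, hence
  series in \<open>t^n\<close>. The product is therefore defined over \<open>\<complex>[[x]]\<close>.
\<close>

lemma conj_poly_descends:
  assumes n: "n > 0"
  obtains q where "map_poly (\<lambda>a. a oo fps_X ^ n) q = conj_poly n \<sigma>"
proof
  define r :: "complex fps \<Rightarrow> complex fps" where "r = (\<lambda>a. Abs_fps (\<lambda>l. a $ (n * l)))"
  have r: "r a oo fps_X ^ n = a" if "\<And>\<delta>. \<delta> ^ n = 1 \<Longrightarrow> turn \<delta> a = a" for a
  proof (rule fps_ext)
    fix k
    have "a $ k = 0" if "\<not> n dvd k"
      using dvd_if_all_roots_of_unity[OF n, of k] that \<open>\<And>\<delta>. \<delta> ^ n = 1 \<Longrightarrow> turn \<delta> a = a\<close>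
      unfolding turn_eq_iff by blast
    then show "(r a oo fps_X ^ n) $ k = a $ k"
      using n by (auto simp: fps_nth_compose_X_power r_def)
  qed
  have "r 0 = 0" by (simp add: r_def fps_eq_iff)
  then show "map_poly (\<lambda>a. a oo fps_X ^ n) (map_poly r (conj_poly n \<sigma>)) = conj_poly n \<sigma>"
    by (intro poly_eqI) (simp add: coeff_map_poly r turn_coeff_conj_poly n)
qed

lemma fps_conv_radius_coeff_conj_poly:
  assumes n: "n > 0" and \<sigma>: "fps_conv_radius \<sigma> > 0"
  shows "fps_conv_radius (poly.coeff (conj_poly n \<sigma>) k) > 0"
proof -
  have 1: "fps_conv_radius \<rho> > 0" if "\<rho> \<in> conjugates n \<sigma>" for \<rho>
    using that \<sigma> norm_root_of_unity[OF n] by (auto simp: conjugates_def intro: fps_conv_radius_turn_pos)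
  have "fps_conv_radius (poly.coeff (\<Prod>\<rho>\<in>R. [:- \<rho>, 1:]) k) > 0" if "R \<subseteq> conjugates n \<sigma>" for R
    using finite_subset[OF that finite_conjugates[OF n]] that
  proof (induction R arbitrary: k rule: finite_induct)
    case empty
    then show ?case by (simp add: coeff_1)
  next
    case (insert \<rho> R)
    have IH: "\<And>k. fps_conv_radius (poly.coeff (\<Prod>\<rho>\<in>R. [:- \<rho>, 1:]) k) > 0"
      using insert by simp
    then obtain f where f: "to_fps f = poly.coeff (\<Prod>\<rho>\<in>R. [:- \<rho>, 1:]) k"
      using Abs_conv_fps_inverse by auto
    obtain g where g: "to_fps g = (case k of 0 \<Rightarrow> 0 | Suc l \<Rightarrow> poly.coeff (\<Prod>\<rho>\<in>R. [:- \<rho>, 1:]) l)"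
      using Abs_conv_fps_inverse[of "poly.coeff (\<Prod>\<rho>\<in>R. [:- \<rho>, 1:]) (k - 1)"] IH to_fps_simps(1)
      by (cases k) (auto simp del: to_fps_simps)
    obtain h where h: "to_fps h = \<rho>" using Abs_conv_fps_inverse[of \<rho>] 1 insert.prems by auto
    have "poly.coeff (\<Prod>\<rho>\<in>insert \<rho> R. [:- \<rho>, 1:]) k = to_fps (g - h * f)"
      using insert.hyps by (simp add: f g h coeff_pCons split: nat.splits)
    then show ?case using Rep_conv_fps[of "g - h * f"] by simp
  qed
  then show ?thesis by (simp add: conj_poly_def)
qed

text \<open>
  A monic polynomial is determined by its roots once there are as many of them as its degree.
\<close>

lemma poly_eq_conj_poly:
  assumes n: "n > 0" and P: "lead_coeff P = 1" "degree P \<le> card (conjugates n \<sigma>)"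
    and roots: "\<And>\<rho>. \<rho> \<in> conjugates n \<sigma> \<Longrightarrow> poly P \<rho> = 0"
  shows "P = conj_poly n \<sigma>"
proof -
  have P0: "P \<noteq> 0" using P by auto
  have "card (conjugates n \<sigma>) \<le> card {\<rho>. poly P \<rho> = 0}"
    using roots poly_roots_finite[OF P0] by (intro card_mono) auto
  also have "\<dots> \<le> degree P" by (rule card_poly_roots_bound[OF P0])
  finally have deg: "degree P = card (conjugates n \<sigma>)" using P by simp
  show ?thesis
  proof (rule poly_eqI_degree_lead_coeff[where n = "degree P" and A = "conjugates n \<sigma>"])
    show "poly.coeff P (degree P) = poly.coeff (conj_poly n \<sigma>) (degree P)"
      using P(1) monic_conj_poly[of n \<sigma>] by (simp add: deg flip: degree_conj_poly)
    fix \<rho> assume "\<rho> \<in> conjugates n \<sigma>"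
    then show "poly P \<rho> = poly (conj_poly n \<sigma>) \<rho>"
      using roots finite_conjugates[OF n] by (auto simp: poly_conj_poly)
  qed (simp_all add: deg degree_conj_poly)
qed

lemma poly_map_poly_fps_to_fls:
  "poly (map_poly fps_to_fls q) (fps_to_fls \<sigma>) = fps_to_fls (poly q \<sigma>)"
  by (induction q) (simp_all add: map_poly_pCons fps_to_fls_plus fls_times_fps_to_fls)

lemma eval_laurent_fps_to_fls:
  assumes "n > 0"
  shows "eval_laurent (map_poly fps_to_fls q) n \<sigma> =
    fps_to_fls (poly (map_poly (\<lambda>a. a oo fps_X ^ n) q) \<sigma>)"
proof -
  have "map_poly (\<lambda>a. fls_compose_power a n) (map_poly fps_to_fls q)
      = map_poly fps_to_fls (map_poly (\<lambda>a. a oo fps_X ^ n) q)"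
    using assms by (intro poly_eqI) (simp add: coeff_map_poly fls_compose_power_fps_to_fls)
  then show ?thesis by (simp add: eval_laurent_def poly_map_poly_fps_to_fls)
qed

text \<open>
  All conjugates are roots of the minimal polynomial, and the product over the conjugates is a
  competitor for minimality by \<open>conj_poly_descends\<close>. So the two agree.
\<close>

lemma base_change_min_poly:
  assumes n: "n > 0" and P: "is_min_poly P n \<sigma>"
  shows "base_change n P = conj_poly n \<sigma>"
proof -
  let ?p = "map_poly (\<lambda>a. fps_to_fls (to_fps a)) P"
  have p_eq: "?p = map_poly fps_to_fls (map_poly to_fps P)"
    by (simp add: map_poly_map_poly comp_def)
  have bc: "map_poly (\<lambda>a. a oo fps_X ^ n) (map_poly to_fps P) = base_change n P"
    by (simp add: base_change_def map_poly_map_poly comp_def)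
  have deg_p: "degree ?p = degree P" by (rule degree_map_poly) simp
  have p: "lead_coeff ?p = 1" "eval_laurent ?p n \<sigma> = 0"
    and min: "\<And>q. q \<noteq> 0 \<Longrightarrow> eval_laurent q n \<sigma> = 0 \<Longrightarrow> degree ?p \<le> degree q"
    using P by (auto simp: is_min_poly_def Let_def)
  obtain q where q: "map_poly (\<lambda>a. a oo fps_X ^ n) q = conj_poly n \<sigma>"
    using conj_poly_descends[OF n] .
  have "degree ?p \<le> degree (map_poly fps_to_fls q)"
  proof (rule min)
    have "poly (conj_poly n \<sigma>) \<sigma> = 0"
      using self_in_conjugates finite_conjugates[OF n] by (auto simp: poly_conj_poly)
    then show "eval_laurent (map_poly fps_to_fls q) n \<sigma> = 0"
      by (simp add: eval_laurent_fps_to_fls[OF n] q)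
    have "conj_poly n \<sigma> \<noteq> 0" using monic_conj_poly[of n \<sigma>] by auto
    then have "q \<noteq> 0" using q by auto
    then show "map_poly fps_to_fls q \<noteq> 0" by (simp add: map_poly_eq_0_iff)
  qed
  also have "\<dots> = degree q" by (rule degree_map_poly) simp
  also have "\<dots> = degree (conj_poly n \<sigma>)"
    unfolding q[symmetric] using compose_X_power_eq_iff[OF n, of _ 0]
    by (intro degree_map_poly[symmetric]) auto
  finally have deg: "degree P \<le> card (conjugates n \<sigma>)" by (simp add: deg_p degree_conj_poly)
  have "eval_param P n \<sigma> = 0"
    using p(2) by (simp add: p_eq eval_laurent_fps_to_fls[OF n] bc eval_param_base_change)
  moreover have "to_fps (lead_coeff P) = 1"
    using p(1) by (simp add: deg_p coeff_map_poly)
  ultimately show ?thesis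
    using deg by (intro poly_eq_conj_poly[OF n])
      (auto simp: degree_base_change n coeff_base_change conjugates_def eval_param_turn
        simp flip: eval_param_base_change)
qed


section \<open>Primitive parameterizations\<close>

text \<open>
  The product over the conjugates of \<open>\<psi>\<close> descends to a convergent polynomial \<open>M\<close>, which divides \<open>G\<close>
  because the remainder has more roots than its degree allows. As \<open>G\<close> is irreducible and \<open>M\<close> is not
  a unit, the cofactor is a unit, that is, a constant. The number of conjugates is \<open>N\<close> as the
  parameterization is primitive.
\<close>

lemma degree_irreducible_param:
  assumes G: "irreducible G" and N: "N > 0" and \<psi>: "fps_conv_radius \<psi> > 0"
    and prim: "Gcd (insert N {k. \<psi> $ k \<noteq> 0}) = 1" and root: "eval_param G N \<psi> = 0"
  shows "degree G = N"
proof -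
  have card: "card (conjugates N \<psi>) = N"
    using card_conjugates[of N 1 \<psi>] primitive_turn_eq_iff[OF N prim] N by simp
  obtain q where q: "map_poly (\<lambda>a. a oo fps_X ^ N) q = conj_poly N \<psi>"
    using conj_poly_descends[OF N] .
  have "fps_conv_radius (poly.coeff q k) > 0" for k
  proof -
    have "poly.coeff (conj_poly N \<psi>) k = poly.coeff q k oo fps_X ^ N"
      by (simp add: coeff_map_poly flip: q)
    then show ?thesis
      using fps_conv_radius_compose_X_power_posD[OF N] fps_conv_radius_coeff_conj_poly[OF N \<psi>] by metis
  qed
  then have A: "to_fps (Abs_conv_fps (poly.coeff q k)) = poly.coeff q k" for k
    by (simp add: Abs_conv_fps_inverse)
  define M where "M = map_poly Abs_conv_fps q"
  have "Abs_conv_fps 0 = 0" by (simp add: zero_conv_fps_def)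
  then have "poly.coeff M k = Abs_conv_fps (poly.coeff q k)" for k
    by (simp add: M_def coeff_map_poly)
  then have M: "base_change N M = conj_poly N \<psi>"
    by (intro poly_eqI) (simp add: coeff_base_change[OF N] A coeff_map_poly flip: q)
  have degM: "degree M = N"
    using degree_base_change[OF N, of M] by (simp add: M degree_conj_poly card)
  have "to_fps (lead_coeff M) oo fps_X ^ N = 1 oo fps_X ^ N"
    using monic_conj_poly[of N \<psi>] coeff_base_change[OF N, of M N]
    by (simp add: M degM degree_conj_poly card)
  then have lc: "lead_coeff M = 1"
    using to_fps_eq_iff[of "lead_coeff M" 1] compose_X_power_eq_iff[OF N, of "to_fps (lead_coeff M)" 1]
    by simp
  have M0: "M \<noteq> 0" using lc by auto
  obtain Q R where "pseudo_divmod G M = (Q, R)" by fastforce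
  from pseudo_divmod[OF M0 this] lc have QR: "G = M * Q + R" "R = 0 \<or> degree R < N"
    by (auto simp: degM)
  have "poly (base_change N R) \<rho> = 0" if "\<rho> \<in> conjugates N \<psi>" for \<rho>
  proof -
    have "eval_param G N \<rho> = 0"
      using that root by (auto simp: conjugates_def eval_param_turn N)
    moreover have "eval_param M N \<rho> = 0"
      using that finite_conjugates[OF N] by (auto simp: eval_param_base_change M poly_conj_poly)
    ultimately show ?thesis
      by (simp add: QR(1) eval_param_add eval_param_mult N flip: eval_param_base_change)
  qed
  then have "R = 0"
    using QR(2) poly_eqI_degree[of "conjugates N \<psi>" "base_change N R" 0]
    by (auto simp: card degree_base_change N base_change_eq_0_iff)
  then have "G = M * Q" using QR by simp
  then have "M dvd 1 \<or> Q dvd 1" using G by (rule irreducibleD[rotated])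
  moreover have "\<not> M dvd 1" using degM N by (auto simp: is_unit_poly_iff)
  ultimately have "degree Q = 0" "Q \<noteq> 0" by (auto simp: is_unit_poly_iff)
  then show ?thesis using \<open>G = M * Q\<close> M0 degM by (simp add: degree_mult_eq)
qed

text \<open>
  After passing to the common first coordinate \<open>t^(n m)\<close>, the \<open>n\<close> conjugates of \<open>c\<close> exhaust the
  roots of \<open>G\<close>, so \<open>\<theta>\<close> is one of them up to the substitutions. Comparing supports and using that
  both parameterizations are primitive gives \<open>m = n\<close>.
\<close>

lemma puiseux_param_unique:
  assumes c: "puiseux_param G n c" and G: "degree G = n" and \<theta>: "puiseux_param G m \<theta>"
  shows "m = n \<and> (\<exists>\<zeta>. \<zeta> ^ n = 1 \<and> \<theta> = turn \<zeta> c)"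
proof -
  have n: "n > 0" and primc: "Gcd (insert n {k. c $ k \<noteq> 0}) = 1" and rootc: "eval_param G n c = 0"
    using c by (auto simp: puiseux_param_def)
  have m: "m > 0" and prim\<theta>: "Gcd (insert m {k. \<theta> $ k \<noteq> 0}) = 1" and root\<theta>: "eval_param G m \<theta> = 0"
    using \<theta> by (auto simp: puiseux_param_def)
  have nm: "n * m > 0" using n m by simp
  let ?L = "base_change (n * m) G"
  have L0: "?L \<noteq> 0" using G n base_change_eq_0_iff[OF nm, of G] by auto
  let ?C = "(\<lambda>\<rho>. \<rho> oo fps_X ^ m) ` conjugates n c"
  have card: "card ?C = n"
    using card_conjugates[of n 1 c] primitive_turn_eq_iff[OF n primc] n
      card_image[OF inj_on_subset[OF inj_compose_X_power[OF m] subset_UNIV]] by simp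
  have rootC: "poly ?L \<rho> = 0" if "\<rho> \<in> ?C" for \<rho>
    using that rootc
    by (auto simp: conjugates_def eval_param_turn n m eval_param_compose_X_power simp flip: eval_param_base_change)
  have root: "poly ?L (\<theta> oo fps_X ^ n) = 0"
    using eval_param_compose_X_power[OF m n, of G \<theta>] root\<theta>
    by (simp add: mult.commute flip: eval_param_base_change)
  have "\<theta> oo fps_X ^ n \<in> ?C"
  proof (rule ccontr)
    assume "\<theta> oo fps_X ^ n \<notin> ?C"
    then have "n + 1 = card (insert (\<theta> oo fps_X ^ n) ?C)"
      using finite_conjugates[OF n] card by simp
    also have "\<dots> \<le> card {\<rho>. poly ?L \<rho> = 0}"
      using poly_roots_finite[OF L0] rootC root by (intro card_mono) auto
    also have "\<dots> \<le> n" using card_poly_roots_bound[OF L0] unfolding degree_base_change[OF nm] G .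
    finally show False by simp
  qed
  then obtain \<zeta> where \<zeta>: "\<zeta> ^ n = 1" and eq: "\<theta> oo fps_X ^ n = turn \<zeta> c oo fps_X ^ m"
    by (auto simp: conjugates_def)
  have \<zeta>0: "\<zeta> \<noteq> 0" using root_of_unity_nonzero n \<zeta> by blast
  have eq': "(\<theta> oo fps_X ^ n) $ k = (turn \<zeta> c oo fps_X ^ m) $ k" for k by (simp add: eq)
  have mn: "m dvd n * k" if "k \<in> insert m {k. \<theta> $ k \<noteq> 0}" for k
    using that eq'[of "n * k"] n m by (auto simp: fps_nth_compose_X_power split: if_splits)
  have nm': "n dvd m * k" if "k \<in> insert n {k. c $ k \<noteq> 0}" for k
    using that eq'[of "m * k"] n m \<zeta>0 by (auto simp: fps_nth_compose_X_power split: if_splits)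
  have "m dvd Gcd ((*) n ` insert m {k. \<theta> $ k \<noteq> 0})"
    using mn by (intro Gcd_greatest) blast
  then have "m dvd n" unfolding Gcd_mult prim\<theta> by simp
  moreover have "n dvd Gcd ((*) m ` insert n {k. c $ k \<noteq> 0})"
    using nm' by (intro Gcd_greatest) blast
  then have "n dvd m" unfolding Gcd_mult primc by simp
  ultimately have "m = n" by (simp add: dvd_antisym)
  with eq \<zeta> compose_X_power_eq_iff[OF n] show ?thesis by auto
qed


section \<open>Contact\<close>

text \<open>
  The orders over which the contact takes the maximum, before division by \<open>n m\<close>.
\<close>

definition contact_set :: "nat \<Rightarrow> complex fps \<Rightarrow> nat \<Rightarrow> complex fps \<Rightarrow> enat set" where
  "contact_set n \<phi> m \<eta> = (\<lambda>(\<gamma>, \<delta>). ord_t ((turn \<gamma> \<phi> oo fps_X ^ m) - (turn \<delta> \<eta> oo fps_X ^ n))) `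
     (roots_of_unity n \<times> roots_of_unity m)"

lemma compose_monomial: "m > 0 \<Longrightarrow> f oo (fps_const \<gamma> * fps_X ^ m) = turn \<gamma> f oo fps_X ^ m"
  by (simp add: fps_compose_assoc[symmetric] fps_compose_mult_distrib)

lemma contact_param_eq:
  assumes "n > 0" "m > 0"
  shows "contact_param n \<phi> m \<eta> =
    Max ((\<lambda>k. ereal_of_enat k / ereal (real (n * m))) ` contact_set n \<phi> m \<eta>)"
proof -
  have "{ereal_of_enat (ord_t (fps_compose \<phi> (fps_const \<gamma> * fps_X ^ m)
                               - fps_compose \<eta> (fps_const \<delta> * fps_X ^ n))) / ereal (real (n * m))
          | \<gamma> \<delta>. \<gamma> ^ n = 1 \<and> \<delta> ^ m = 1}
     = (\<lambda>k. ereal_of_enat k / ereal (real (n * m))) ` contact_set n \<phi> m \<eta>"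
    using assms unfolding contact_set_def compose_monomial[OF assms(1)] compose_monomial[OF assms(2)]
    by (auto simp: image_iff split_paired_Bex_Sigma)
  then show ?thesis by (simp only: contact_param_def)
qed

lemma contact_set_turn:
  assumes nm: "n > 0" "m > 0" and \<zeta>: "\<zeta> ^ n = 1" and \<xi>: "\<xi> ^ m = 1"
  shows "contact_set n (turn \<zeta> \<phi>) m (turn \<xi> \<eta>) = contact_set n \<phi> m \<eta>"
proof -
  have sub: "contact_set n (turn \<zeta> \<phi>) m (turn \<xi> \<eta>) \<subseteq> contact_set n \<phi> m \<eta>"
    if "\<zeta> ^ n = 1" "\<xi> ^ m = 1" for \<zeta> \<xi> \<phi> \<eta>
  proof
    fix k assume "k \<in> contact_set n (turn \<zeta> \<phi>) m (turn \<xi> \<eta>)"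
    then obtain \<gamma> \<delta> where "\<gamma> ^ n = 1" "\<delta> ^ m = 1" and
      "k = ord_t ((turn (\<gamma> * \<zeta>) \<phi> oo fps_X ^ m) - (turn (\<delta> * \<xi>) \<eta> oo fps_X ^ n))"
      by (auto simp: contact_set_def turn_turn)
    then show "k \<in> contact_set n \<phi> m \<eta>"
      unfolding contact_set_def using that
      by (intro image_eqI[of _ _ "(\<gamma> * \<zeta>, \<delta> * \<xi>)"]) (auto simp: power_mult_distrib)
  qed
  have "\<zeta> \<noteq> 0" "\<xi> \<noteq> 0" using root_of_unity_nonzero nm \<zeta> \<xi> by blast+
  then have "\<phi> = turn (1 / \<zeta>) (turn \<zeta> \<phi>)" "\<eta> = turn (1 / \<xi>) (turn \<xi> \<eta>)"
    by (simp_all add: turn_turn)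
  with sub[of "1 / \<zeta>" "1 / \<xi>" "turn \<zeta> \<phi>" "turn \<xi> \<eta>"] sub[OF \<zeta> \<xi>, of \<phi> \<eta>] \<zeta> \<xi>
  show ?thesis by (simp add: power_divide)
qed

text \<open>
  By \<open>puiseux_param_unique\<close> other parameterizations differ by rotations, and these permute the
  contact set.
\<close>

lemma contact_eq:
  assumes F: "puiseux_param F n c" "degree F = n" and G: "puiseux_param G m \<psi>" "degree G = m"
  shows "contact F G = contact_param n c m \<psi>"
  unfolding contact_def
proof (rule the_equality)
  have nm: "n > 0" "m > 0" using F G by (auto simp: puiseux_param_def)
  show "\<forall>n' \<phi> m' \<eta>. puiseux_param F n' \<phi> \<longrightarrow> puiseux_param G m' \<eta> \<longrightarrow>
      contact_param n c m \<psi> = contact_param n' \<phi> m' \<eta>"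
  proof (intro allI impI)
    fix n' \<phi> m' \<eta> assume "puiseux_param F n' \<phi>" "puiseux_param G m' \<eta>"
    then obtain \<zeta> \<xi> where "n' = n" "\<zeta> ^ n = 1" "\<phi> = turn \<zeta> c" "m' = m" "\<xi> ^ m = 1" "\<eta> = turn \<xi> \<psi>"
      using puiseux_param_unique[OF F] puiseux_param_unique[OF G] by blast
    then show "contact_param n c m \<psi> = contact_param n' \<phi> m' \<eta>"
      by (simp add: contact_param_eq nm contact_set_turn)
  qed
qed (use F G in blast)


section \<open>Relative closeness of power series\<close>

lemma fps_X_power_dvd_iff:
  "fps_X ^ d dvd (f :: complex fps) \<longleftrightarrow> f = 0 \<or> d \<le> subdegree f"
  by (cases "f = 0") (auto simp: fps_dvd_iff)

text \<open>
  The relative error of \<open>f'\<close> with respect to \<open>f\<close> has order at least \<open>d\<close>. Unlike the order of the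
  difference \<open>f' - f\<close>, this bound is the same for all factors and for their product.
\<close>

definition rel_close :: "nat \<Rightarrow> complex fps \<Rightarrow> complex fps \<Rightarrow> bool" where
  "rel_close d f f' \<longleftrightarrow> (\<exists>\<epsilon>. f' = f * (1 + \<epsilon>) \<and> fps_X ^ d dvd \<epsilon>)"

lemma rel_close_refl: "rel_close d f f"
  unfolding rel_close_def by (rule exI[of _ 0]) auto

lemma rel_close_mono: "rel_close d f f' \<Longrightarrow> d' \<le> d \<Longrightarrow> rel_close d' f f'"
  unfolding rel_close_def using power_le_dvd by blast

lemma rel_close_mult:
  assumes "rel_close d f f'" "rel_close d g g'"
  shows "rel_close d (f * g) (f' * g')"
proof -
  obtain \<epsilon> \<mu> where "f' = f * (1 + \<epsilon>)" "fps_X ^ d dvd \<epsilon>" "g' = g * (1 + \<mu>)" "fps_X ^ d dvd \<mu>"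
    using assms by (auto simp: rel_close_def)
  then show ?thesis
    unfolding rel_close_def by (intro exI[of _ "\<epsilon> + \<mu> + \<epsilon> * \<mu>"]) (auto simp: algebra_simps)
qed

lemma rel_close_prod:
  "(\<And>x. x \<in> A \<Longrightarrow> rel_close d (f x) (f' x)) \<Longrightarrow> rel_close d (prod f A) (prod f' A)"
  by (induction A rule: infinite_finite_induct) (auto intro: rel_close_refl rel_close_mult)

text \<open>
  A relative error survives addition as long as there is no cancellation of leading terms: both
  summands are then multiples of the sum.
\<close>

lemma rel_close_add:
  assumes fg: "rel_close d f f'" "rel_close d g g'" and nz: "f \<noteq> 0" "g \<noteq> 0"
    and ne: "subdegree f \<noteq> subdegree g"
  shows "rel_close d (f + g) (f' + g')"
proof -
  obtain \<epsilon> \<mu> where 1: "f' = f * (1 + \<epsilon>)" "fps_X ^ d dvd \<epsilon>" "g' = g * (1 + \<mu>)" "fps_X ^ d dvd \<mu>"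
    using fg by (auto simp: rel_close_def)
  have "f + g \<noteq> 0"
    using ne by (metis add_eq_0_iff2 subdegree_uminus)
  moreover have "subdegree (f + g) \<le> subdegree f" "subdegree (f + g) \<le> subdegree g"
    using ne nz subdegree_add_eq1[of f g] subdegree_add_eq2[of g f] by linarith+
  ultimately have "f + g dvd f" "f + g dvd g" using nz by (auto simp: fps_dvd_iff)
  then obtain p q where pq: "f = (f + g) * p" "g = (f + g) * q" by (auto elim!: dvdE)
  have "f' + g' = f + g + f * \<epsilon> + g * \<mu>" by (simp add: 1 algebra_simps)
  also have "\<dots> = f + g + ((f + g) * p) * \<epsilon> + ((f + g) * q) * \<mu>" by (simp only: pq[symmetric])
  also have "\<dots> = (f + g) * (1 + (p * \<epsilon> + q * \<mu>))" by (simp add: algebra_simps)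
  finally show ?thesis
    unfolding rel_close_def using 1 by (intro exI[of _ "p * \<epsilon> + q * \<mu>"]) auto
qed

lemma rel_closeI:
  assumes "f \<noteq> 0" "f' = f \<or> subdegree f + d \<le> subdegree (f' - f)"
  shows "rel_close d f f'"
proof (cases "f' = f")
  case True
  then show ?thesis by (simp add: rel_close_refl)
next
  case False
  then have "f' - f \<noteq> 0" by simp
  moreover have le: "subdegree f + d \<le> subdegree (f' - f)" using assms False by simp
  ultimately have "f dvd f' - f" using assms by (simp add: fps_dvd_iff)
  then obtain \<epsilon> where \<epsilon>: "f' - f = f * \<epsilon>" by (rule dvdE)
  then have "f' = f * (1 + \<epsilon>)" by (simp add: algebra_simps)
  moreover have "fps_X ^ d dvd \<epsilon>"
    using le \<open>f' - f \<noteq> 0\<close> unfolding \<epsilon> fps_X_power_dvd_iff by (cases "\<epsilon> = 0") auto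
  ultimately show ?thesis by (auto simp: rel_close_def)
qed


section \<open>Characteristic exponents\<close>

text \<open>
  The characteristic data of a branch depend on its parameterization alone.
\<close>

locale puiseux_branch =
  fixes n :: nat and c :: "complex fps"
  assumes n: "n > 0"
    and primitive: "Gcd (insert n {k. c $ k \<noteq> 0}) = 1"
    and normalized: "\<exists>b>n. \<not> n dvd b \<and> c $ b \<noteq> 0 \<and> (\<forall>k<b. c $ k = 0)"
begin

abbreviation e where "e \<equiv> char_gcd n c"
abbreviation \<beta> where "\<beta> \<equiv> char_exp n c"
abbreviation g where "g \<equiv> genus n c"
abbreviation v where "v \<equiv> sg_gen n c"

text \<open>
  The defining equations turn \<open>e (Suc k)\<close> and \<open>\<beta> (Suc k)\<close> into \<open>LEAST\<close> terms; the arguments below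
  work with their characteristic properties \<open>e_Suc\<close> and \<open>\<beta>_Suc\<close> instead.
\<close>

declare char_gcd.simps [simp del] char_exp.simps [simp del]

lemma e_0 [simp]: "e 0 = n" and \<beta>_0 [simp]: "\<beta> 0 = n"
  by (simp_all add: char_gcd.simps char_exp.simps)

lemma \<beta>_Suc_Least: "\<beta> (Suc k) = (LEAST l. \<not> e k dvd l \<and> c $ l \<noteq> 0)"
  by (simp add: char_exp.simps)

lemma e_Suc: "e (Suc k) = gcd (e k) (\<beta> (Suc k))"
  by (simp add: char_gcd.simps char_exp.simps)

lemma e_Suc_dvd: "e (Suc k) dvd e k"
  by (simp add: e_Suc)

lemma \<beta>_1_Least: "\<beta> (Suc 0) = (LEAST l. \<not> n dvd l \<and> c $ l \<noteq> 0)"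
  by (simp add: \<beta>_Suc_Least)

lemma e_pos: "e k > 0"
  by (induction k) (use n in \<open>auto simp: e_Suc\<close>)

lemma e_antimono: "i \<le> k \<Longrightarrow> e k dvd e i"
  by (induction k rule: dec_induct) (auto intro: dvd_trans e_Suc_dvd)

lemma e_dvd_n: "e k dvd n"
  using e_antimono[of 0 k] by simp

lemma e_dvd_\<beta>: "i \<le> k \<Longrightarrow> e k dvd \<beta> i"
proof -
  assume "i \<le> k"
  moreover have "e i dvd \<beta> i" by (cases i) (auto simp: e_Suc)
  ultimately show ?thesis using e_antimono dvd_trans by blast
qed

lemma \<beta>_Suc:
  assumes "e k \<noteq> 1"
  shows "\<not> e k dvd \<beta> (Suc k)" "c $ \<beta> (Suc k) \<noteq> 0"
    and "\<And>l. l < \<beta> (Suc k) \<Longrightarrow> c $ l \<noteq> 0 \<Longrightarrow> e k dvd l"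
proof -
  have "\<exists>l. \<not> e k dvd l \<and> c $ l \<noteq> 0"
  proof (rule ccontr)
    assume "\<not> ?thesis"
    then have "e k dvd Gcd (insert n {l. c $ l \<noteq> 0})"
      using e_dvd_n by (intro Gcd_greatest) auto
    then have "e k dvd 1" by (simp only: primitive)
    then show False using assms by simp
  qed
  from LeastI_ex[OF this] show "\<not> e k dvd \<beta> (Suc k)" "c $ \<beta> (Suc k) \<noteq> 0"
    by (auto simp: \<beta>_Suc_Least)
  show "e k dvd l" if "l < \<beta> (Suc k)" "c $ l \<noteq> 0" for l
    using not_less_Least[of l "\<lambda>l. \<not> e k dvd l \<and> c $ l \<noteq> 0"] that
    by (auto simp: \<beta>_Suc_Least)
qed

lemma e_genus: "e g = 1" and e_neq_1: "k < g \<Longrightarrow> e k \<noteq> 1"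
proof -
  have "\<exists>k. e k = 1"
  proof (rule ccontr)
    assume *: "\<not> ?thesis"
    have "e (Suc k) < e k" for k
    proof -
      have "e (Suc k) dvd e k" by (rule e_Suc_dvd)
      moreover have "e (Suc k) \<noteq> e k" using \<beta>_Suc(1)[of k] * by (metis e_Suc gcd_dvd2)
      ultimately show ?thesis using dvd_imp_le[OF _ e_pos] le_neq_implies_less by blast
    qed
    then have "e k + k \<le> e 0" for k
    proof (induction k)
      case (Suc k)
      from Suc.IH[OF Suc.prems] Suc.prems[of k] show ?case by linarith
    qed simp
    from this[of "Suc (e 0)"] show False by simp
  qed
  from LeastI_ex[OF this] show "e g = 1" by (simp add: genus_def)
  show "k < g \<Longrightarrow> e k \<noteq> 1" unfolding genus_def using not_less_Least by blast
qed

lemma \<beta>_1: "n < \<beta> 1" "\<And>k. k < \<beta> 1 \<Longrightarrow> c $ k = 0"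
proof -
  obtain b where b: "b > n" "\<not> n dvd b" "c $ b \<noteq> 0" "\<And>k. k < b \<Longrightarrow> c $ k = 0"
    using normalized by blast
  have "\<beta> 1 = b"
    unfolding One_nat_def \<beta>_1_Least
  proof (rule Least_equality)
    show "b \<le> l" if "\<not> n dvd l \<and> c $ l \<noteq> 0" for l
      using b(4)[of l] that by (meson not_le)
  qed (use b in auto)
  with b show "n < \<beta> 1" "\<And>k. k < \<beta> 1 \<Longrightarrow> c $ k = 0" by auto
qed

text \<open>
  Below \<open>\<beta>_i\<close> the series \<open>c\<close> is a series in \<open>t^(e_(i-1))\<close>, and hence in \<open>t^(e_k)\<close> for all
  \<open>k \<ge> i - 1\<close>.
\<close>

lemma c_below:
  assumes "0 < i" "i \<le> g" "l < \<beta> i" "c $ l \<noteq> 0" "i \<le> Suc k"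
  shows "e k dvd l"
proof -
  obtain i' where i: "i = Suc i'" using assms(1) by (cases i) auto
  then have "e i' dvd l" using \<beta>_Suc(3)[OF e_neq_1, of i'] assms by simp
  moreover have "e k dvd e i'" using e_antimono[of i' k] assms i by simp
  ultimately show ?thesis by (rule dvd_trans[rotated])
qed

lemma \<beta>_less_Suc: "k < g \<Longrightarrow> \<beta> k < \<beta> (Suc k)"
proof (cases k)
  case 0
  then show ?thesis using \<beta>_1(1) by simp
next
  case (Suc k')
  assume k: "k < g"
  have 1: "\<not> e k dvd \<beta> (Suc k)" "c $ \<beta> (Suc k) \<noteq> 0" using \<beta>_Suc e_neq_1[OF k] by auto
  show ?thesis
  proof (rule ccontr)
    assume "\<not> \<beta> k < \<beta> (Suc k)"
    then consider "\<beta> (Suc k) < \<beta> k" | "\<beta> (Suc k) = \<beta> k" by linarith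
    then show False
    proof cases
      case 1
      then have "e k' dvd \<beta> (Suc k)" using c_below[of k "\<beta> (Suc k)" k'] \<open>c $ \<beta> (Suc k) \<noteq> 0\<close> k Suc by auto
      then show False using e_antimono[of k' k] Suc \<open>\<not> e k dvd \<beta> (Suc k)\<close> dvd_trans by auto
    next
      case 2
      then show False using 1 e_dvd_\<beta>[of k k] by simp
    qed
  qed
qed

lemma \<beta>_less: "i < k \<Longrightarrow> k \<le> g \<Longrightarrow> \<beta> i < \<beta> k"
proof (induction k)
  case (Suc k)
  then show ?case using \<beta>_less_Suc[of k] by (cases "i = k") auto
qed simp

lemma \<beta>_le: "i \<le> k \<Longrightarrow> k \<le> g \<Longrightarrow> \<beta> i \<le> \<beta> k"
  using \<beta>_less[of i k] by (cases "i = k") auto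

lemma c_\<beta>: "1 \<le> i \<Longrightarrow> i \<le> g \<Longrightarrow> c $ \<beta> i \<noteq> 0"
  using \<beta>_Suc(2)[OF e_neq_1, of "i - 1"] by simp

lemma dvd_e: "x dvd n \<Longrightarrow> (\<And>i. 1 \<le> i \<Longrightarrow> i \<le> k \<Longrightarrow> x dvd \<beta> i) \<Longrightarrow> x dvd e k"
proof (induction k)
  case (Suc k)
  then have "x dvd e k" "x dvd \<beta> (Suc k)" by auto
  then show ?case unfolding e_Suc by (rule gcd_greatest)
qed simp

lemma root_of_unity_e:
  fixes \<gamma> :: complex
  shows "\<gamma> ^ n = 1 \<Longrightarrow> (\<And>i. 1 \<le> i \<Longrightarrow> i \<le> k \<Longrightarrow> \<gamma> ^ \<beta> i = 1) \<Longrightarrow> \<gamma> ^ e k = 1"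
proof (induction k)
  case (Suc k)
  then have "\<gamma> ^ e k = 1" "\<gamma> ^ \<beta> (Suc k) = 1" by auto
  then show ?case unfolding e_Suc by (rule root_of_unity_gcd[OF e_pos])
qed simp


text \<open>
  Modulo \<open>e_k\<close> the generator \<open>v_(k+1)\<close> is congruent to \<open>\<beta>_(k+1)\<close>, since \<open>e_k\<close> divides \<open>\<beta>_k\<close> and
  \<open>v_k\<close>.
\<close>

lemma gcd_e_v: "k < g \<Longrightarrow> gcd (e k) (v (Suc k)) = e (Suc k)"
proof (induction k)
  case (Suc k)
  let ?r = "char_ratio n c (Suc k)"
  have IH: "e (Suc k) dvd v (Suc k)" using Suc by (metis Suc_lessD gcd_dvd2)
  have "\<beta> (Suc k) < \<beta> (Suc (Suc k))" using \<beta>_less_Suc[OF Suc.prems] .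
  then have eq: "v (Suc (Suc k)) + \<beta> (Suc k) = ?r * v (Suc k) + \<beta> (Suc (Suc k))"
    by simp
  have "x dvd v (Suc (Suc k)) \<longleftrightarrow> x dvd \<beta> (Suc (Suc k))" if "x dvd e (Suc k)" for x
  proof -
    have 1: "x dvd \<beta> (Suc k)" using that e_dvd_\<beta>[of "Suc k" "Suc k"] dvd_trans by blast
    have 2: "x dvd ?r * v (Suc k)" using dvd_trans[OF that IH] by (rule dvd_mult)
    have "x dvd v (Suc (Suc k)) \<longleftrightarrow> x dvd v (Suc (Suc k)) + \<beta> (Suc k)"
      using 1 by (rule dvd_add_left_iff[symmetric])
    also have "\<dots> \<longleftrightarrow> x dvd \<beta> (Suc (Suc k))"
      unfolding eq using 2 by (rule dvd_add_right_iff)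
    finally show ?thesis .
  qed
  then have "gcd (e (Suc k)) (v (Suc (Suc k))) = gcd (e (Suc k)) (\<beta> (Suc (Suc k)))"
    by (intro dvd_antisym gcd_greatest) (auto simp del: sg_gen.simps)
  then show ?case by (simp only: e_Suc)
qed (simp add: e_Suc)

lemma e_Suc_times_ratio: "char_ratio n c (Suc k) * e (Suc k) = e k"
proof -
  have "e (Suc k) dvd e k" by (rule e_Suc_dvd)
  then show ?thesis by simp
qed


section \<open>Distances to the conjugates of a truncation\<close>

text \<open>
  The series whose minimal polynomial is the semiroot \<open>F_i\<close>.
\<close>

abbreviation trunc :: "nat \<Rightarrow> complex fps" where
  "trunc i \<equiv> fps_cutoff (\<beta> i) c"

lemma nth_c_minus_turn_trunc:
  "(c - turn \<gamma> (trunc i)) $ l = (if l < \<beta> i then (1 - \<gamma> ^ l) * c $ l else c $ l)"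
  by (simp only: fps_sub_nth fps_nth_compose_linear fps_cutoff_nth) (simp add: left_diff_distrib)

text \<open>
  The support of the truncation together with \<open>n\<close> generates the same gcd as
  \<open>n, \<beta>_1, \<dots>, \<beta>_k\<close>, namely \<open>e_k\<close>.
\<close>

lemma turn_trunc_eq_iff:
  assumes "k < g" "\<gamma> ^ n = 1"
  shows "turn \<gamma> (trunc (Suc k)) = trunc (Suc k) \<longleftrightarrow> \<gamma> ^ e k = 1"
proof
  assume *: "turn \<gamma> (trunc (Suc k)) = trunc (Suc k)"
  show "\<gamma> ^ e k = 1"
  proof (rule root_of_unity_e[OF assms(2)])
    fix i assume i: "1 \<le> i" "i \<le> k"
    then have "trunc (Suc k) $ \<beta> i \<noteq> 0"
      using assms(1) \<beta>_less[of i "Suc k"] c_\<beta>[of i] by simp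
    then show "\<gamma> ^ \<beta> i = 1" using * unfolding turn_eq_iff by blast
  qed
next
  assume "\<gamma> ^ e k = 1"
  then show "turn \<gamma> (trunc (Suc k)) = trunc (Suc k)"
    unfolding turn_eq_iff
    using c_below[of "Suc k" _ k] assms(1)
    by (auto intro: root_of_unity_dvd split: if_splits)
qed

lemma subdegree_c_minus_trunc:
  assumes "k < g" "\<gamma> ^ n = 1" "\<gamma> ^ e k = 1"
  shows "subdegree (c - turn \<gamma> (trunc (Suc k))) = \<beta> (Suc k)"
  using turn_trunc_eq_iff[OF assms(1,2)] assms(3) c_\<beta>[of "Suc k"] assms(1)
  by (intro subdegreeI) (auto)

lemma ex_difference:
  assumes "k \<le> g" "\<gamma> ^ n = 1" "\<gamma> ^ e k \<noteq> 1" 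
  obtains i where "1 \<le> i" "i \<le> k" "(1 - \<gamma> ^ \<beta> i) * c $ \<beta> i \<noteq> 0"
proof -
  obtain i where "1 \<le> i" "i \<le> k" "\<gamma> ^ \<beta> i \<noteq> 1"
    using root_of_unity_e[OF assms(2), of k] assms(3) by blast
  then show thesis using that[of i] c_\<beta>[of i] assms(1) by auto
qed

lemma c_minus_turn_trunc_nonzero:
  assumes "k < g"
  shows "c - turn \<gamma> (trunc (Suc k)) \<noteq> 0"
proof -
  have "(c - turn \<gamma> (trunc (Suc k))) $ \<beta> (Suc k) \<noteq> 0"
    unfolding nth_c_minus_turn_trunc using c_\<beta>[of "Suc k"] assms by simp
  then show ?thesis by (metis fps_zero_nth)
qed

lemma subdegree_c_minus_turn_trunc_less:
  assumes "k < g" "\<gamma> ^ n = 1" "\<gamma> ^ e k \<noteq> 1"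
  shows "subdegree (c - turn \<gamma> (trunc (Suc k))) < \<beta> (Suc k)"
proof -
  obtain i where i: "1 \<le> i" "i \<le> k" "(1 - \<gamma> ^ \<beta> i) * c $ \<beta> i \<noteq> 0"
    using ex_difference[of k \<gamma>] assms by auto
  have "\<beta> i < \<beta> (Suc k)" using \<beta>_less i assms by auto
  moreover from this have "subdegree (c - turn \<gamma> (trunc (Suc k))) \<le> \<beta> i"
    using i by (intro subdegree_leI) (simp only: nth_c_minus_turn_trunc if_True simp_thms)
  ultimately show ?thesis by simp
qed

text \<open>
  If \<open>\<gamma>\<close> moves one of the terms up to \<open>\<beta>_(k+1)\<close>, the first difference from \<open>c\<close> occurs there
  already, and lengthening the truncation beyond this exponent has no effect.
\<close>

lemma subdegree_c_minus_turn_trunc_Suc: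
  assumes "Suc k < g" "\<gamma> ^ n = 1" "\<gamma> ^ e (Suc k) \<noteq> 1"
  shows "subdegree (c - turn \<gamma> (trunc (Suc (Suc k)))) = subdegree (c - turn \<gamma> (trunc (Suc k)))"
proof -
  let ?f = "c - turn \<gamma> (trunc (Suc (Suc k)))"
  let ?b = "\<beta> (Suc k)"
  obtain i where i: "1 \<le> i" "i \<le> Suc k" "(1 - \<gamma> ^ \<beta> i) * c $ \<beta> i \<noteq> 0"
    using ex_difference[of "Suc k" \<gamma>] assms by auto
  have "\<beta> i \<le> ?b" using \<beta>_le i assms by auto
  have bb: "?b < \<beta> (Suc (Suc k))" using \<beta>_less assms by auto
  have "subdegree ?f \<le> \<beta> i"
    using i \<open>\<beta> i \<le> ?b\<close> bb
    by (intro subdegree_leI) (simp add: nth_c_minus_turn_trunc)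
  with \<open>\<beta> i \<le> ?b\<close> have L: "subdegree ?f \<le> ?b" by simp
  have f0: "?f \<noteq> 0" using c_minus_turn_trunc_nonzero assms by simp
  have "subdegree (c - turn \<gamma> (trunc (Suc k))) = subdegree ?f"
  proof (rule subdegreeI)
    have "?f $ subdegree ?f \<noteq> 0" using f0 by (rule nth_subdegree_nonzero)
    then show "(c - turn \<gamma> (trunc (Suc k))) $ subdegree ?f \<noteq> 0"
      unfolding nth_c_minus_turn_trunc using L bb
      by (cases "subdegree ?f < \<beta> (Suc k)") (auto split: if_splits)
    fix l assume l: "l < subdegree ?f"
    then have "?f $ l = 0" by auto
    then show "(c - turn \<gamma> (trunc (Suc k))) $ l = 0"
      unfolding nth_c_minus_turn_trunc using l L bb by simp
  qed
  then show ?thesis by simp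
qed

text \<open>
  Passing from \<open>k\<close> to \<open>k + 1\<close> raises the distance from \<open>\<beta>_(k+1)\<close> to \<open>\<beta>_(k+2)\<close> for the
  \<open>e_(k+1)\<close> roots of unity that fix the longer truncation, and changes no other distance. Multiplied
  by \<open>e_(k+1)\<close>, the recursion of \<open>v\<close> says the same.
\<close>

lemma sum_subdegree_c_minus_turn_trunc:
  "k < g \<Longrightarrow> (\<Sum>\<gamma>\<in>roots_of_unity n. subdegree (c - turn \<gamma> (trunc (Suc k)))) = e k * v (Suc k)"
proof (induction k)
  case 0
  have "(\<Sum>\<gamma>\<in>roots_of_unity n. subdegree (c - turn \<gamma> (trunc (Suc 0)))) = (\<Sum>\<gamma>\<in>roots_of_unity n. \<beta> 1)"
    using subdegree_c_minus_trunc[OF 0] by (intro sum.cong) auto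
  then show ?case using n by (simp add: card_roots_unity_eq)
next
  case (Suc k)
  let ?d = "\<lambda>k \<gamma>. subdegree (c - turn \<gamma> (trunc (Suc k)))"
  let ?inc = "\<beta> (Suc (Suc k)) - \<beta> (Suc k)"
  have b: "\<beta> (Suc k) < \<beta> (Suc (Suc k))" using \<beta>_less_Suc[OF Suc.prems] .
  have "?d (Suc k) \<gamma> = ?d k \<gamma> + (if \<gamma> ^ e (Suc k) = 1 then ?inc else 0)" if \<gamma>: "\<gamma> ^ n = 1" for \<gamma>
  proof (cases "\<gamma> ^ e (Suc k) = 1")
    case True
    moreover have "\<gamma> ^ e k = 1" using True e_antimono[of k "Suc k"] root_of_unity_dvd by auto
    ultimately show ?thesis
      using subdegree_c_minus_trunc[of k \<gamma>] subdegree_c_minus_trunc[of "Suc k" \<gamma>] Suc.prems \<gamma> b by simp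
  next
    case False
    then show ?thesis using subdegree_c_minus_turn_trunc_Suc[OF Suc.prems \<gamma>] by simp
  qed
  then have "(\<Sum>\<gamma>\<in>roots_of_unity n. ?d (Suc k) \<gamma>)
      = (\<Sum>\<gamma>\<in>roots_of_unity n. ?d k \<gamma> + (if \<gamma> ^ e (Suc k) = 1 then ?inc else 0))"
    by (intro sum.cong) auto
  also have "\<dots> = (\<Sum>\<gamma>\<in>roots_of_unity n. ?d k \<gamma>)
      + (\<Sum>\<gamma>\<in>{\<gamma> \<in> roots_of_unity n. \<gamma> ^ e (Suc k) = 1}. ?inc)"
    unfolding sum.distrib using finite_roots_of_unity[OF n] by (subst sum.inter_filter) auto
  also have "{\<gamma> \<in> roots_of_unity n. \<gamma> ^ e (Suc k) = 1} = roots_of_unity (e (Suc k))"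
    using root_of_unity_dvd[OF _ e_dvd_n] by blast
  also have "(\<Sum>\<gamma>\<in>roots_of_unity (e (Suc k)). ?inc) = e (Suc k) * ?inc"
    using card_roots_unity_eq[OF e_pos[of "Suc k"]] by simp
  also have "(\<Sum>\<gamma>\<in>roots_of_unity n. ?d k \<gamma>) = e k * v (Suc k)"
    using Suc by simp
  also have "e k * v (Suc k) = e (Suc k) * (char_ratio n c (Suc k) * v (Suc k))"
    by (metis e_Suc_times_ratio mult.assoc mult.commute)
  also have "\<dots> + e (Suc k) * ?inc = e (Suc k) * (char_ratio n c (Suc k) * v (Suc k) + ?inc)"
    by (rule distrib_left[symmetric])
  also have "char_ratio n c (Suc k) * v (Suc k) + ?inc = v (Suc (Suc k))"
    using b by simp
  finally show ?case .
qed

end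


section \<open>Semiroots\<close>

lemma monic_min_poly:
  assumes "is_min_poly P n \<sigma>"
  shows "lead_coeff P = 1"
proof -
  have "degree (map_poly (\<lambda>a. fps_to_fls (to_fps a)) P) = degree P"
    by (rule degree_map_poly) simp
  then have "to_fps (lead_coeff P) = 1"
    using assms by (simp add: is_min_poly_def Let_def coeff_map_poly)
  then show ?thesis using to_fps_eq_iff[of "lead_coeff P" 1] by simp
qed

locale branch_with_semiroots = puiseux_branch +
  fixes S :: "nat \<Rightarrow> conv_fps poly"
  assumes min_poly: "k < genus n c \<Longrightarrow> is_min_poly (S (Suc k)) n (trunc (Suc k))"
begin

lemma eval_S:
  assumes "k < g"
  shows "eval_param (S (Suc k)) n \<eta> = (\<Prod>\<rho>\<in>conjugates n (trunc (Suc k)). \<eta> - \<rho>)"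
  using base_change_min_poly[OF n min_poly[OF assms]]
  by (simp add: eval_param_base_change poly_conj_poly)

lemma degree_S:
  assumes "k < g"
  shows "degree (S (Suc k)) = n div e k"
proof -
  have "degree (S (Suc k)) = degree (conj_poly n (trunc (Suc k)))"
    using base_change_min_poly[OF n min_poly[OF assms]] degree_base_change[OF n, of "S (Suc k)"] by simp
  then show ?thesis
    using card_conjugates[OF n e_dvd_n turn_trunc_eq_iff[OF assms]] by (simp add: degree_conj_poly)
qed

lemma c_minus_conjugate_nonzero:
  "k < g \<Longrightarrow> \<rho> \<in> conjugates n (trunc (Suc k)) \<Longrightarrow> c - \<rho> \<noteq> 0"
  using c_minus_turn_trunc_nonzero unfolding conjugates_def by blast

lemma eval_S_c_nonzero:
  assumes "k < g"
  shows "eval_param (S (Suc k)) n c \<noteq> 0"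
proof -
  have "finite (conjugates n (trunc (Suc k)))" by (rule finite_conjugates[OF n])
  then show ?thesis
    unfolding eval_S[OF assms] using c_minus_conjugate_nonzero[OF assms] by (subst prod_zero_iff) auto
qed

text \<open>
  This is \<open>I(F, F_(k+1)) = v_(k+1)\<close>: the value is the sum of the distances of \<open>c\<close> to the
  conjugates of the truncation.
\<close>

lemma subdegree_eval_S_c:
  assumes "k < g"
  shows "subdegree (eval_param (S (Suc k)) n c) = v (Suc k)"
proof -
  have "e k * subdegree (eval_param (S (Suc k)) n c)
      = e k * (\<Sum>\<rho>\<in>conjugates n (trunc (Suc k)). subdegree (c - \<rho>))"
    unfolding eval_S[OF assms]
    by (subst subdegree_prod) (use c_minus_conjugate_nonzero[OF assms] in auto)
  also have "\<dots> = (\<Sum>\<gamma>\<in>roots_of_unity n. subdegree (c - turn \<gamma> (trunc (Suc k))))"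
    using sum_conjugates[OF n e_dvd_n turn_trunc_eq_iff[OF assms], of "\<lambda>\<rho>. subdegree (c - \<rho>)"]
    by (simp only:)
  also have "\<dots> = e k * v (Suc k)" by (rule sum_subdegree_c_minus_turn_trunc[OF assms])
  finally show ?thesis using e_pos[of k] by (metis mult_cancel1 less_numeral_extra(3))
qed

end


section \<open>Values along a second curve close to the branch\<close>

text \<open>
  The curve \<open>(t^n, \<eta>(t))\<close> agrees with the branch beyond the characteristic exponent \<open>\<beta>_J\<close>.
\<close>

locale close_curve = branch_with_semiroots +
  fixes \<eta> :: "complex fps" and J K :: nat
  assumes J: "J \<le> genus n c" and neq: "\<eta> \<noteq> c" and K_def: "K = subdegree (\<eta> - c)"
    and K: "char_exp n c J < K"
begin

text \<open>
  Replacing \<open>c\<close> by \<open>\<eta>\<close> multiplies a factor \<open>c - \<rho>\<close> of the value of the semiroot by \<open>1 + \<epsilon>\<close>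
  with \<open>ord \<epsilon> = K - ord (c - \<rho>)\<close>. The distance \<open>ord (c - \<rho>)\<close> is \<open>\<beta>_(k+1)\<close> for the truncation
  itself and smaller for all its other conjugates, so the smallest order of an \<open>\<epsilon>\<close> occurs only once
  and is the order of the total relative error.
\<close>

lemma semiroot_quotient:
  assumes "k < J"
  obtains \<epsilon> where "eval_param (S (Suc k)) n \<eta> = eval_param (S (Suc k)) n c * (1 + \<epsilon>)"
    "\<epsilon> \<noteq> 0" "subdegree \<epsilon> = K - \<beta> (Suc k)"
proof -
  have k: "k < g" using assms J by simp
  have bK: "\<beta> (Suc k) < K" using \<beta>_le[of "Suc k" J] assms J K by simp
  let ?R = "conjugates n (trunc (Suc k))" and ?\<sigma> = "trunc (Suc k)"
  have fin: "finite ?R" by (rule finite_conjugates[OF n])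
  have \<sigma>: "c - ?\<sigma> \<noteq> 0" "subdegree (c - ?\<sigma>) = \<beta> (Suc k)"
    using c_minus_conjugate_nonzero[OF k self_in_conjugates] subdegree_c_minus_trunc[OF k, of 1]
    by auto
  have \<delta>: "\<eta> - c \<noteq> 0" using neq by simp
  then have "c - ?\<sigma> dvd \<eta> - c" using \<sigma> bK K_def by (simp add: fps_dvd_iff)
  then obtain \<epsilon>1 where \<epsilon>1: "\<eta> - c = (c - ?\<sigma>) * \<epsilon>1" by (rule dvdE)
  have \<epsilon>1_nz: "\<epsilon>1 \<noteq> 0" using \<delta> \<epsilon>1 by auto
  have \<epsilon>1_sub: "subdegree \<epsilon>1 = K - \<beta> (Suc k)"
    using \<sigma> \<epsilon>1_nz unfolding K_def \<epsilon>1 by (subst subdegree_mult) auto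
  define d where "d = K - \<beta> (Suc k)"
  have "rel_close (Suc d) (\<Prod>\<rho>\<in>?R - {?\<sigma>}. c - \<rho>) (\<Prod>\<rho>\<in>?R - {?\<sigma>}. \<eta> - \<rho>)"
  proof (rule rel_close_prod)
    fix \<rho> assume \<rho>: "\<rho> \<in> ?R - {?\<sigma>}"
    then obtain \<gamma> where \<gamma>: "\<gamma> ^ n = 1" "\<rho> = turn \<gamma> ?\<sigma>" by (auto simp: conjugates_def)
    have "\<gamma> ^ e k \<noteq> 1" using \<rho> \<gamma> turn_trunc_eq_iff[OF k \<gamma>(1)] by auto
    then have "subdegree (c - \<rho>) < \<beta> (Suc k)"
      using subdegree_c_minus_turn_trunc_less[OF k \<gamma>(1)] \<gamma> by simp
    moreover have "(\<eta> - \<rho>) - (c - \<rho>) = \<eta> - c" by simp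
    ultimately show "rel_close (Suc d) (c - \<rho>) (\<eta> - \<rho>)"
      using c_minus_conjugate_nonzero[OF k, of \<rho>] \<rho> bK
      by (intro rel_closeI) (auto simp: d_def K_def)
  qed
  then obtain \<epsilon>2 where \<epsilon>2: "(\<Prod>\<rho>\<in>?R - {?\<sigma>}. \<eta> - \<rho>) = (\<Prod>\<rho>\<in>?R - {?\<sigma>}. c - \<rho>) * (1 + \<epsilon>2)"
    "fps_X ^ Suc d dvd \<epsilon>2" by (auto simp: rel_close_def)
  define \<epsilon> where "\<epsilon> = \<epsilon>1 + \<epsilon>2 * (1 + \<epsilon>1)"
  have dvd: "fps_X ^ Suc d dvd \<epsilon>2 * (1 + \<epsilon>1)" using \<epsilon>2(2) by (rule dvd_mult2)
  have sub: "subdegree \<epsilon>1 = d" using \<epsilon>1_sub d_def by simp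
  have eps: "\<epsilon> \<noteq> 0 \<and> subdegree \<epsilon> = d"
  proof (cases "\<epsilon>2 * (1 + \<epsilon>1) = 0")
    case True
    then have "\<epsilon> = \<epsilon>1" by (simp only: \<epsilon>_def add_0_right)
    then show ?thesis using \<epsilon>1_nz sub by simp
  next
    case False
    then have "Suc d \<le> subdegree (\<epsilon>2 * (1 + \<epsilon>1))" using dvd fps_X_power_dvd_iff by blast
    then have *: "subdegree \<epsilon> = d"
      unfolding \<epsilon>_def using \<epsilon>1_nz sub by (subst subdegree_add_eq1) auto
    moreover have "(\<epsilon>2 * (1 + \<epsilon>1)) $ d = 0"
      using \<open>Suc d \<le> _\<close> by (intro nth_less_subdegree_zero) linarith
    then have "\<epsilon> $ d = \<epsilon>1 $ d" unfolding \<epsilon>_def fps_add_nth by (simp only: add_0_right)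
    then have "\<epsilon> $ d \<noteq> 0" using nth_subdegree_nonzero[OF \<epsilon>1_nz] sub by metis
    then have "\<epsilon> \<noteq> 0" by auto
    ultimately show ?thesis by simp
  qed
  have split: "(\<Prod>\<rho>\<in>?R. f \<rho>) = f ?\<sigma> * (\<Prod>\<rho>\<in>?R - {?\<sigma>}. f \<rho>)" for f :: "_ \<Rightarrow> complex fps"
    by (rule prod.remove[OF fin self_in_conjugates])
  have "\<eta> - ?\<sigma> = (c - ?\<sigma>) * (1 + \<epsilon>1)" using \<epsilon>1 by (simp add: algebra_simps)
  then have "eval_param (S (Suc k)) n \<eta> = (c - ?\<sigma>) * (1 + \<epsilon>1) * ((\<Prod>\<rho>\<in>?R - {?\<sigma>}. c - \<rho>) * (1 + \<epsilon>2))"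
    unfolding eval_S[OF k] by (subst split) (simp only: \<epsilon>2(1))
  also have "\<dots> = (c - ?\<sigma>) * (\<Prod>\<rho>\<in>?R - {?\<sigma>}. c - \<rho>) * ((1 + \<epsilon>1) * (1 + \<epsilon>2))"
    by (simp only: mult_ac)
  also have "\<dots> = eval_param (S (Suc k)) n c * ((1 + \<epsilon>1) * (1 + \<epsilon>2))"
    unfolding eval_S[OF k] by (subst split) simp
  also have "(1 + \<epsilon>1) * (1 + \<epsilon>2) = 1 + \<epsilon>" by (simp add: \<epsilon>_def algebra_simps)
  finally show thesis using that[of \<epsilon>] eps d_def by simp
qed

text \<open>
  Divide repeatedly by the semiroot \<open>G = F_(k+1)\<close>, so that \<open>H\<close> becomes a sum of terms \<open>R G^a\<close> with
  \<open>deg R < deg G\<close> and \<open>a < e_k/e_(k+1)\<close>. By induction the value of \<open>R\<close> is divisible by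
  \<open>e_k\<close>, whereas the multiples \<open>a v_(k+1)\<close> are pairwise incongruent modulo \<open>e_k\<close>. So the terms
  have different orders along the branch, no leading terms cancel, and relative closeness passes from the
  terms to the sum by \<open>rel_close_add\<close>. The statement on divisibility is what keeps the induction
  going.
\<close>

lemma small_degree:
  assumes "k \<le> J" "H \<noteq> 0" "degree H < n div e k"
  shows "eval_param H n c \<noteq> 0 \<and> e k dvd subdegree (eval_param H n c) \<and>
    rel_close (K - \<beta> k) (eval_param H n c) (eval_param H n \<eta>)"
  using assms
proof (induction k arbitrary: H)
  case 0
  then have "degree H = 0" using n by simp
  then obtain a where H: "H = [:a:]" by (rule degree_eq_zeroE)
  with 0 have a: "a \<noteq> 0" by auto
  have ev: "eval_param H n x = to_fps a oo fps_X ^ n" for x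
    by (simp add: H eval_param_pCons n) (simp add: eval_param_def)
  have "to_fps a oo fps_X ^ n \<noteq> 0" using a compose_X_power_eq_0_iff[OF n] by blast
  then show ?case using n by (simp add: ev rel_close_refl)
next
  case (Suc k)
  have k: "k < J" "k < g" using Suc.prems(1) J by auto
  define G where "G = S (Suc k)"
  define m where "m = n div e k"
  define r where "r = char_ratio n c (Suc k)"
  define d where "d = K - \<beta> (Suc k)"
  have m: "m > 0" using n e_dvd_n[of k] by (simp add: m_def div_greater_zero_iff dvd_imp_le e_pos)
  have er: "r * e (Suc k) = e k" unfolding r_def by (rule e_Suc_times_ratio)
  have "n = m * (r * e (Suc k))" using e_dvd_n[of k] by (simp add: m_def er)
  then have "n div e (Suc k) = m * r * e (Suc k) div e (Suc k)" by (simp only: mult.assoc)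
  then have nr: "n div e (Suc k) = m * r" using e_pos[of "Suc k"] by simp
  have G: "degree G = m" "lead_coeff G = 1" "G \<noteq> 0"
    using degree_S[OF k(2)] monic_min_poly[OF min_poly[OF k(2)]] by (auto simp: G_def m_def)
  have Gm: "poly.coeff G m = 1" using G by simp
  let ?G = "eval_param G n c"
  have Gc: "?G \<noteq> 0" "subdegree ?G = v (Suc k)"
    using eval_S_c_nonzero[OF k(2)] subdegree_eval_S_c[OF k(2)] by (simp_all add: G_def)
  have Gclose: "rel_close d ?G (eval_param G n \<eta>)"
  proof -
    obtain \<epsilon> where "eval_param G n \<eta> = ?G * (1 + \<epsilon>)" "\<epsilon> \<noteq> 0" "subdegree \<epsilon> = K - \<beta> (Suc k)"
      using semiroot_quotient[OF k(1)] unfolding G_def by blast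
    then show ?thesis unfolding rel_close_def d_def fps_X_power_dvd_iff by auto
  qed
  have gcd: "gcd (e k) (v (Suc k)) = e (Suc k)" by (rule gcd_e_v[OF k(2)])
  have IH: "eval_param R n c \<noteq> 0 \<and> e k dvd subdegree (eval_param R n c) \<and>
    rel_close d (eval_param R n c) (eval_param R n \<eta>)" if "R \<noteq> 0" "degree R < m" for R
  proof -
    have "d \<le> K - \<beta> k" using \<beta>_less_Suc[OF k(2)] by (simp add: d_def)
    then show ?thesis using Suc.IH[OF _ that(1)] that(2) Suc.prems(1) rel_close_mono
      unfolding m_def by auto
  qed
  \<comment> \<open>Induction on the number \<open>q\<close> of terms: with \<open>H = G Q + R\<close> the quotient \<open>Q\<close> has one term fewer.\<close>
  have "eval_param H n c \<noteq> 0 \<and> (\<exists>M. \<exists>a<q. e k dvd M \<and> subdegree (eval_param H n c) = M + a * v (Suc k)) \<and>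
      rel_close d (eval_param H n c) (eval_param H n \<eta>)"
    if "q \<le> r" "H \<noteq> 0" "degree H < m * q" for q H
    using that
  proof (induction q arbitrary: H)
    case (Suc q)
    obtain Q R where "pseudo_divmod H G = (Q, R)" by fastforce
    from pseudo_divmod[OF G(3) this] have QR: "H = G * Q + R" "R = 0 \<or> degree R < m"
      by (auto simp: G(1) Gm)
    have ev: "eval_param H n x = eval_param G n x * eval_param Q n x + eval_param R n x" for x
      by (simp add: QR(1) eval_param_add eval_param_mult n)
    show ?case
    proof (cases "Q = 0")
      case True
      then have "H = R" using QR by simp
      then show ?thesis using IH[of R] QR(2) Suc.prems(2) by (intro conjI exI[of _ 0] exI[of _ "subdegree (eval_param H n c)"]) auto
    next
      case False
      have "degree (G * Q) = m + degree Q" using False G by (simp add: degree_mult_eq)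
      moreover have "degree H = degree (G * Q)"
      proof (cases "R = 0")
        case False
        then show ?thesis unfolding QR(1) using QR(2) calculation by (intro degree_add_eq_left) auto
      qed (simp add: QR(1))
      ultimately have "degree Q < m * q" using Suc.prems(3) by simp
      then obtain M a where Q: "eval_param Q n c \<noteq> 0" "a < q" "e k dvd M"
        "subdegree (eval_param Q n c) = M + a * v (Suc k)" "rel_close d (eval_param Q n c) (eval_param Q n \<eta>)"
        using Suc.IH[of Q] False Suc.prems(1) by auto
      let ?GQ = "\<lambda>x. eval_param G n x * eval_param Q n x"
      have GQ: "?GQ c \<noteq> 0" "subdegree (?GQ c) = M + Suc a * v (Suc k)" "rel_close d (?GQ c) (?GQ \<eta>)"
        using Gc Q Gclose by (auto intro: rel_close_mult)
      show ?thesis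
      proof (cases "R = 0")
        case True
        then have ev': "eval_param H n x = ?GQ x" for x by (simp add: ev) (simp add: eval_param_def)
        show ?thesis unfolding ev' using GQ Q(2,3) by blast
      next
        case False
        then have R: "eval_param R n c \<noteq> 0" "e k dvd subdegree (eval_param R n c)"
          "rel_close d (eval_param R n c) (eval_param R n \<eta>)"
          using IH[of R] QR(2) by auto
        \<comment> \<open>Equal orders would make \<open>e_k\<close> divide \<open>(a + 1) v_(k+1)\<close>, and so \<open>e_k/e_(k+1)\<close> divide \<open>a + 1\<close>.\<close>
        have ne: "subdegree (?GQ c) \<noteq> subdegree (eval_param R n c)"
        proof
          assume "subdegree (?GQ c) = subdegree (eval_param R n c)"
          then have "e k dvd M + Suc a * v (Suc k)" using R GQ by simp
          then have "e k dvd Suc a * v (Suc k)" using Q(3) by (simp only: dvd_add_right_iff)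
          then have "e k dvd gcd (Suc a * e k) (Suc a * v (Suc k))" by simp
          also have "gcd (Suc a * e k) (Suc a * v (Suc k)) = Suc a * e (Suc k)"
            unfolding gcd[symmetric] by (rule gcd_mult_distrib_nat[symmetric])
          finally have "r * e (Suc k) dvd Suc a * e (Suc k)" by (simp only: er)
          then have "r dvd Suc a" using e_pos[of "Suc k"] by (simp only: dvd_times_right_cancel_iff neq0_conv)
          then have "r \<le> Suc a" by (rule dvd_imp_le) simp
          then show False using Q(2) Suc.prems(1) by simp
        qed
        have "rel_close d (eval_param H n c) (eval_param H n \<eta>)"
          unfolding ev by (rule rel_close_add[OF GQ(3) R(3) GQ(1) R(1) ne])
        moreover have "subdegree (eval_param H n c) = subdegree (?GQ c) \<or>
            subdegree (eval_param H n c) = subdegree (eval_param R n c)"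
          unfolding ev using ne GQ(1) R(1) subdegree_add_eq1[of "?GQ c" "eval_param R n c"]
            subdegree_add_eq2[of "eval_param R n c" "?GQ c"] by linarith
        moreover have "eval_param H n c \<noteq> 0"
          unfolding ev using ne by (metis add_eq_0_iff2 subdegree_uminus)
        moreover have "\<exists>M. \<exists>a<Suc q. e k dvd M \<and> subdegree (eval_param H n c) = M + a * v (Suc k)"
          using calculation(2)
        proof
          assume "subdegree (eval_param H n c) = subdegree (?GQ c)"
          then show ?thesis using GQ(2) Q(2,3) by (intro exI[of _ M] exI[of _ "Suc a"]) simp
        next
          assume "subdegree (eval_param H n c) = subdegree (eval_param R n c)"
          then show ?thesis using R(2)
            by (intro exI[of _ "subdegree (eval_param R n c)"] exI[of _ 0]) simp
        qed
        ultimately show ?thesis by blast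
      qed
    qed
  qed simp
  from this[of r H] Suc.prems nr obtain M a where
    "eval_param H n c \<noteq> 0" "e k dvd M" "subdegree (eval_param H n c) = M + a * v (Suc k)"
    "rel_close d (eval_param H n c) (eval_param H n \<eta>)" by auto
  moreover have "e (Suc k) dvd v (Suc k)" using gcd by (metis gcd_dvd2)
  moreover have "e (Suc k) dvd M" using e_Suc_dvd[of k] calculation(2) by (rule dvd_trans)
  ultimately show ?case unfolding d_def by simp
qed

end


section \<open>Comparing two pullbacks\<close>

lemma fps_X_power_dvd_deriv:
  assumes "fps_X ^ Suc d dvd (f :: complex fps)"
  shows "fps_X ^ d dvd fps_deriv f"
proof -
  have "fps_deriv f $ k = 0" if "k < d" for k
    using assms that unfolding fps_X_power_dvd_iff by (auto intro: nth_less_subdegree_zero)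
  then show ?thesis
    unfolding fps_X_power_dvd_iff by (metis subdegree_geI)
qed

lemma subdegree_fps_deriv:
  fixes f :: "complex fps"
  assumes "f \<noteq> 0" "subdegree f > 0"
  shows "fps_deriv f \<noteq> 0 \<and> subdegree (fps_deriv f) = subdegree f - 1"
proof -
  have *: "fps_deriv f $ (subdegree f - 1) \<noteq> 0" using assms by simp
  have "subdegree (fps_deriv f) = subdegree f - 1"
  proof (rule subdegreeI[OF *])
    fix l assume "l < subdegree f - 1"
    then have "f $ Suc l = 0" by (intro nth_less_subdegree_zero) simp
    then show "fps_deriv f $ l = 0" by simp
  qed
  moreover have "fps_deriv f \<noteq> 0" using * by (metis fps_zero_nth)
  ultimately show ?thesis by simp
qed

text \<open>
  The Euler operator \<open>t d/dt\<close> multiplies the leading term by its exponent; working with it avoids a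
  separate case for order zero.
\<close>

lemma X_times_deriv:
  fixes f :: "complex fps"
  obtains u where "fps_X * fps_deriv f = of_nat (subdegree f) * f + fps_X * (fps_X ^ subdegree f * u)"
proof -
  define m u where "m = subdegree f" and "u = fps_shift m f"
  have f: "f = u * fps_X ^ m" unfolding u_def m_def by (rule subdegree_decompose)
  have "fps_X * fps_deriv (fps_X ^ m :: complex fps) = of_nat m * fps_X ^ m"
  proof (rule fps_ext)
    fix k
    show "(fps_X * fps_deriv (fps_X ^ m)) $ k = (of_nat m * fps_X ^ m :: complex fps) $ k"
      by (cases k) (auto simp: fps_X_power_nth fps_of_nat[symmetric] simp del: fps_deriv_power)
  qed
  then have "fps_X * fps_deriv f = of_nat m * f + fps_X * (fps_X ^ m * fps_deriv u)"
    unfolding f fps_deriv_mult by (simp add: algebra_simps)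
  then show thesis using that m_def by blast
qed

text \<open>
  The weights are chosen so that the leading terms of the two products cancel: \<open>t a'\<close> and
  \<open>t b'\<close> agree with \<open>p a\<close> and \<open>q b\<close> up to higher order, and \<open>p a (q b) - q b (p a) = 0\<close>. This
  gains one order compared with either product.
\<close>

lemma weighted_wronskian_dvd:
  fixes a b :: "complex fps"
  shows "fps_X ^ (subdegree a + subdegree b) dvd
    of_nat (subdegree a) * a * fps_deriv b - of_nat (subdegree b) * b * fps_deriv a"
proof -
  let ?p = "subdegree a" and ?q = "subdegree b"
  obtain u where u: "fps_X * fps_deriv a = of_nat ?p * a + fps_X * (fps_X ^ ?p * u)"
    using X_times_deriv .
  obtain w where w: "fps_X * fps_deriv b = of_nat ?q * b + fps_X * (fps_X ^ ?q * w)"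
    using X_times_deriv .
  let ?W = "of_nat ?p * a * fps_deriv b - of_nat ?q * b * fps_deriv a"
  have "fps_X * ?W = of_nat ?p * a * (fps_X * fps_deriv b) - of_nat ?q * b * (fps_X * fps_deriv a)"
    by (simp add: algebra_simps)
  also have "\<dots> = fps_X * (of_nat ?p * a * (fps_X ^ ?q * w) - of_nat ?q * b * (fps_X ^ ?p * u))"
    unfolding u w by (simp add: algebra_simps)
  finally have W: "?W = of_nat ?p * a * (fps_X ^ ?q * w) - of_nat ?q * b * (fps_X ^ ?p * u)"
    unfolding mult_cancel_left by simp
  have "fps_X ^ ?p dvd a" "fps_X ^ ?q dvd b" by (auto simp: fps_X_power_dvd_iff)
  then have "fps_X ^ ?p * fps_X ^ ?q dvd a * (fps_X ^ ?q * w)"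
    and "fps_X ^ ?q * fps_X ^ ?p dvd b * (fps_X ^ ?p * u)"
    by (auto intro: mult_dvd_mono simp del: dvd_triv_left)
  then have "fps_X ^ (?p + ?q) dvd of_nat ?p * (a * (fps_X ^ ?q * w))"
    and "fps_X ^ (?p + ?q) dvd of_nat ?q * (b * (fps_X ^ ?p * u))"
    by (simp_all only: dvd_mult power_add mult.commute[of "fps_X ^ ?q" "fps_X ^ ?p"])
  then have "fps_X ^ (?p + ?q) dvd of_nat ?p * a * (fps_X ^ ?q * w) - of_nat ?q * b * (fps_X ^ ?p * u)"
    by (simp only: mult.assoc dvd_diff)
  then show ?thesis by (simp only: W)
qed

text \<open>
  Here \<open>a\<close>, \<open>b\<close>, \<open>h\<close>, \<open>r\<close> stand for the values of \<open>F_i\<close>, \<open>F_j\<close>, \<open>H_1\<close>, \<open>H_2\<close> along the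
  branch, and the primed series for the values along the separatrix. Subtracting the vanishing primed
  expression leaves \<open>- p h a b \<mu>'\<close>, whose order is the asserted one, up to terms of higher order.
\<close>

lemma subdegree_pullback_of_close_separatrix:
  fixes a b h r a' b' h' r' :: "complex fps"
  defines "p \<equiv> subdegree a" and "q \<equiv> subdegree b"
  assumes nz: "a \<noteq> 0" "b \<noteq> 0" "h \<noteq> 0" and p: "p > 0" and d: "d > 0"
    and a': "rel_close (Suc d) a a'"
    and b': "b' = b * (1 + \<mu>)" "\<mu> \<noteq> 0" "subdegree \<mu> = d"
    and h': "rel_close d h h'" and r': "rel_close d r r'"
    and r: "r = 0 \<or> subdegree h + p + q < subdegree r"
    and sep: "h' * (of_nat p * a' * fps_deriv b' - of_nat q * b' * fps_deriv a') + fps_deriv r' = 0"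
  shows "h * (of_nat p * a * fps_deriv b - of_nat q * b * fps_deriv a) + fps_deriv r \<noteq> 0 \<and>
    Suc (subdegree (h * (of_nat p * a * fps_deriv b - of_nat q * b * fps_deriv a) + fps_deriv r))
      = subdegree h + p + q + d"
proof -
  let ?s = "subdegree h"
  obtain \<epsilon> where \<epsilon>: "a' = a * (1 + \<epsilon>)" "fps_X ^ Suc d dvd \<epsilon>" using a' by (auto simp: rel_close_def)
  obtain \<kappa> where \<kappa>: "h' = h * (1 + \<kappa>)" "fps_X ^ d dvd \<kappa>" using h' by (auto simp: rel_close_def)
  obtain \<iota> where \<iota>: "r' = r * (1 + \<iota>)" "fps_X ^ d dvd \<iota>" using r' by (auto simp: rel_close_def)
  define W where "W = of_nat p * a * fps_deriv b - of_nat q * b * fps_deriv a"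
  define P where "P = h * W + fps_deriv r"
  define M where "M = h * of_nat p * a * b * fps_deriv \<mu>"
  define E where "E = (1 + \<kappa>) * (1 + \<epsilon>) * (1 + \<mu>) - 1"
  define R where "R = (h * (1 + \<kappa>) * (1 + \<mu>) * of_nat q * a * b) * fps_deriv \<epsilon>
      - h * E * W - (\<kappa> + \<epsilon> + \<kappa> * \<epsilon>) * M - fps_deriv (r * \<iota>)"
  define T where "T = ?s + p + q + d"
  \<comment> \<open>\<open>M\<close> is the dominating term up to sign, \<open>R\<close> collects all the others.\<close>
  have "P = P - (h' * (of_nat p * a' * fps_deriv b' - of_nat q * b' * fps_deriv a') + fps_deriv r')"
    by (simp only: sep diff_zero)
  also have "\<dots> = R - M"
    unfolding P_def R_def M_def E_def W_def \<epsilon>(1) \<kappa>(1) \<iota>(1) b'(1)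
    by (simp add: algebra_simps)
  finally have PR: "P = R - M" .
  have \<mu>_dvd: "fps_X ^ d dvd \<mu>" using b' by (simp add: fps_X_power_dvd_iff)
  have \<epsilon>_dvd: "fps_X ^ d dvd \<epsilon>" using \<epsilon>(2) by (rule power_le_dvd) simp
  have dh: "fps_X ^ ?s dvd h" and da: "fps_X ^ p dvd a" and db: "fps_X ^ q dvd b"
    by (auto simp: fps_X_power_dvd_iff p_def q_def)
  have dhab: "fps_X ^ (?s + p + q) dvd h * a * b"
    unfolding power_add by (intro mult_dvd_mono dh da db)
  have \<mu>_deriv: "fps_deriv \<mu> \<noteq> 0" "subdegree (fps_deriv \<mu>) = d - 1"
    using subdegree_fps_deriv[of \<mu>] b' d by auto
  have M_nz: "M \<noteq> 0" and M_sub: "Suc (subdegree M) = T"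
    using nz p \<mu>_deriv d by (auto simp: M_def T_def p_def q_def simp flip: fps_of_nat)
  have "fps_X ^ T dvd R"
    unfolding R_def
  proof (intro dvd_diff)
    have "fps_X ^ T dvd (h * a * b) * fps_deriv \<epsilon>"
      unfolding T_def power_add[of _ "?s + p + q"]
      by (intro mult_dvd_mono dhab fps_X_power_dvd_deriv[OF \<epsilon>(2)])
    then have "fps_X ^ T dvd ((1 + \<kappa>) * (1 + \<mu>) * of_nat q) * ((h * a * b) * fps_deriv \<epsilon>)"
      by (rule dvd_mult)
    then show "fps_X ^ T dvd (h * (1 + \<kappa>) * (1 + \<mu>) * of_nat q * a * b) * fps_deriv \<epsilon>"
      by (simp only: mult_ac)
    have "E = \<kappa> + \<epsilon> * (1 + \<kappa>) + \<mu> * ((1 + \<kappa>) * (1 + \<epsilon>))" by (simp add: E_def algebra_simps)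
    then have dE: "fps_X ^ d dvd E" using \<kappa>(2) \<epsilon>_dvd \<mu>_dvd by (auto intro!: dvd_add)
    have "fps_X ^ (p + q) dvd W"
      unfolding W_def p_def q_def by (rule weighted_wronskian_dvd)
    then have "fps_X ^ ?s * fps_X ^ d * fps_X ^ (p + q) dvd h * E * W"
      by (intro mult_dvd_mono dh dE)
    moreover have "fps_X ^ ?s * fps_X ^ d * fps_X ^ (p + q) = (fps_X ^ T :: complex fps)"
      by (simp add: T_def ac_simps flip: power_add)
    ultimately show "fps_X ^ T dvd h * E * W" by simp
    have "fps_X ^ d dvd \<kappa> + \<epsilon> + \<kappa> * \<epsilon>" using \<kappa>(2) \<epsilon>_dvd by auto
    moreover have "fps_X ^ (T - 1) dvd M" unfolding fps_X_power_dvd_iff by (intro disjI2) (use M_sub in linarith)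
    ultimately have "fps_X ^ (d + (T - 1)) dvd (\<kappa> + \<epsilon> + \<kappa> * \<epsilon>) * M"
      unfolding power_add by (rule mult_dvd_mono)
    then show "fps_X ^ T dvd (\<kappa> + \<epsilon> + \<kappa> * \<epsilon>) * M"
      by (rule power_le_dvd) (use d in simp)
    have "fps_X ^ (?s + p + q + 1) dvd r"
      unfolding fps_X_power_dvd_iff using r by linarith
    then have "fps_X ^ (?s + p + q + 1 + d) dvd r * \<iota>"
      unfolding power_add[of _ "?s + p + q + 1"] using \<iota>(2) by (rule mult_dvd_mono)
    then have "fps_X ^ Suc T dvd r * \<iota>" by (simp add: T_def)
    then show "fps_X ^ T dvd fps_deriv (r * \<iota>)" by (rule fps_X_power_dvd_deriv)
  qed
  then have R: "R = 0 \<or> T \<le> subdegree R" by (simp add: fps_X_power_dvd_iff)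
  have "P $ subdegree M \<noteq> 0"
  proof -
    have "R $ subdegree M = 0" using R M_sub by (auto intro: nth_less_subdegree_zero)
    then show ?thesis using M_nz by (simp add: PR)
  qed
  moreover from this have "subdegree P = subdegree M"
  proof (rule subdegreeI)
    fix l assume l: "l < subdegree M"
    then have "R $ l = 0" "M $ l = 0" using R M_sub by (auto intro: nth_less_subdegree_zero)
    then show "P $ l = 0" by (simp add: PR)
  qed
  ultimately have "P \<noteq> 0 \<and> Suc (subdegree P) = T"
    using M_sub by (metis fps_zero_nth)
  then show ?thesis unfolding P_def W_def T_def .
qed


section \<open>Value and contact of a nearby separatrix\<close>

lemma ord_t_greater_iff: "enat b < ord_t f \<longleftrightarrow> (\<forall>l\<le>b. f $ l = 0)"
proof (cases "f = 0")
  case False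
  have "b < subdegree f \<longleftrightarrow> (\<forall>l\<le>b. f $ l = 0)"
  proof
    assume "b < subdegree f"
    then show "\<forall>l\<le>b. f $ l = 0" using nth_less_subdegree_zero le_less_trans by blast
  next
    assume "\<forall>l\<le>b. f $ l = 0"
    then show "b < subdegree f" using False by (intro subdegree_greaterI) simp_all
  qed
  then show ?thesis using False by (simp add: ord_t_def)
qed (simp add: ord_t_def)

lemma ord_t_turn:
  assumes "\<gamma> \<noteq> 0"
  shows "ord_t (turn \<gamma> f) = ord_t f"
proof -
  have "turn \<gamma> f = 0 \<longleftrightarrow> f = 0" using assms by (auto simp: fps_eq_iff)
  moreover have "subdegree (turn \<gamma> f) = subdegree f"
    using assms by (subst subdegree_fps_compose) auto
  ultimately show ?thesis by (simp add: ord_t_def)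
qed

lemma ord_t_compose_X_power:
  assumes "m > 0"
  shows "ord_t (f oo fps_X ^ m) = enat m * ord_t f"
  using compose_X_power_eq_iff[OF assms, of f 0] assms
  by (auto simp: ord_t_def zero_enat_def mult.commute)

context puiseux_branch
begin

lemma v_pos: "i \<le> g \<Longrightarrow> v i > 0"
proof (cases i)
  case (Suc k)
  assume "i \<le> g"
  then show ?thesis
  proof (cases k)
    case 0
    then show ?thesis using Suc \<beta>_1(1) n by simp
  next
    case (Suc k')
    then show ?thesis using \<open>i = Suc k\<close> \<beta>_less_Suc[of "Suc k'"] \<open>i \<le> g\<close> by simp
  qed
qed (use n in simp)

text \<open>
  The pair of trivial rotations gives the maximum. If \<open>c\<close> rotated by \<open>\<zeta>\<close> agrees with \<open>\<eta>\<close> up to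
  \<open>\<beta>_j\<close>, then \<open>\<zeta>\<close> fixes the terms of \<open>c\<close> with the exponents \<open>\<beta>_1, \<dots>, \<beta>_j\<close>, whence
  \<open>\<zeta>^(e_j) = 1\<close>. So \<open>\<zeta>\<close> fixes \<open>\<eta>\<close>, and rotating \<open>c\<close> by \<open>\<zeta>\<close> amounts to rotating the whole
  difference \<open>c - \<eta>\<close>, which does not change its order.
\<close>

lemma contact_param_value:
  assumes j: "j \<le> g" and N: "N = n div e j" and \<eta>: "\<eta> = \<psi> oo fps_X ^ e j"
    and agree: "\<And>l. l \<le> \<beta> j \<Longrightarrow> \<eta> $ l = c $ l"
  shows "contact_param n c N \<psi> = ereal_of_enat (ord_t (c - \<eta>)) / ereal (real n)"
proof -
  have nN: "n = N * e j" using N e_dvd_n[of j] by simp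
  have N0: "N > 0" using n e_dvd_n[of j] e_pos[of j] by (simp add: N div_greater_zero_iff dvd_imp_le)
  have e0: "e j > 0" by (rule e_pos)
  have big: "enat (\<beta> j) < ord_t (c - \<eta>)" using agree by (simp add: ord_t_greater_iff)
  have le: "ord_t (turn \<zeta> c - \<eta>) \<le> ord_t (c - \<eta>)" if \<zeta>: "\<zeta> ^ n = 1" for \<zeta>
  proof (cases "enat (\<beta> j) < ord_t (turn \<zeta> c - \<eta>)")
    case True
    have "\<zeta> ^ e j = 1"
    proof (rule root_of_unity_e[OF \<zeta>])
      fix i assume i: "1 \<le> i" "i \<le> j"
      have "\<beta> i \<le> \<beta> j" using \<beta>_le i j by simp
      then have "(turn \<zeta> c - \<eta>) $ \<beta> i = 0" "\<eta> $ \<beta> i = c $ \<beta> i"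
        using True agree by (auto simp only: ord_t_greater_iff)
      then show "\<zeta> ^ \<beta> i = 1" using c_\<beta>[of i] i j by simp
    qed
    then have "turn \<zeta> \<eta> = \<eta>" by (simp add: \<eta> turn_compose_X_power[OF e0])
    then have "turn \<zeta> c - \<eta> = turn \<zeta> (c - \<eta>)" by (simp add: fps_compose_sub_distrib)
    then show ?thesis using ord_t_turn[OF root_of_unity_nonzero[OF n \<zeta>]] by simp
  next
    case False
    then show ?thesis using big by simp
  qed
  \<comment> \<open>An \<open>N\<close>-th root of unity is written as \<open>\<delta>^(e_j)\<close>, so that both rotations act on series in the same parameter.\<close>
  have elt: "ord_t ((turn \<gamma> c oo fps_X ^ N) - (turn (\<delta> ^ e j) \<psi> oo fps_X ^ n))
      = enat N * ord_t (turn (\<gamma> / \<delta>) c - \<eta>)" if "\<delta> ^ n = 1" for \<gamma> \<delta>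
  proof -
    have \<delta>0: "\<delta> \<noteq> 0" by (rule root_of_unity_nonzero[OF n that])
    have "(fps_X :: complex fps) ^ (e j * N) = fps_X ^ n" using nN by (metis mult.commute)
    then have "turn (\<delta> ^ e j) \<psi> oo fps_X ^ n = turn (\<delta> ^ e j) \<psi> oo fps_X ^ e j oo fps_X ^ N"
      by (simp only: compose_X_power_X_power[OF e0 N0])
    also have "\<dots> = turn \<delta> \<eta> oo fps_X ^ N"
      by (simp add: \<eta> turn_compose_X_power[OF e0])
    finally have "(turn \<gamma> c oo fps_X ^ N) - (turn (\<delta> ^ e j) \<psi> oo fps_X ^ n)
        = (turn \<gamma> c - turn \<delta> \<eta>) oo fps_X ^ N"
      by (simp add: fps_compose_sub_distrib)
    also have "turn \<gamma> c - turn \<delta> \<eta> = turn \<delta> (turn (\<gamma> / \<delta>) c - \<eta>)"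
      using \<delta>0 by (simp only: fps_compose_sub_distrib turn_turn) simp
    finally show ?thesis by (simp only: ord_t_compose_X_power[OF N0] ord_t_turn[OF \<delta>0])
  qed
  let ?A = "contact_set n c N \<psi>" and ?f = "\<lambda>k. ereal_of_enat k / ereal (real (n * N))"
  have "Max (?f ` ?A) = ?f (enat N * ord_t (c - \<eta>))"
  proof (rule Max_eqI)
    show "finite (?f ` ?A)"
      unfolding contact_set_def using finite_roots_of_unity n N0 by simp
    have "enat N * ord_t (c - \<eta>) \<in> ?A"
      unfolding contact_set_def using elt[of 1 1] by (intro image_eqI[of _ _ "(1, 1)"]) auto
    then show "?f (enat N * ord_t (c - \<eta>)) \<in> ?f ` ?A" by blast
    fix y assume "y \<in> ?f ` ?A"
    then obtain \<gamma> \<delta>' where *: "\<gamma> ^ n = 1" "\<delta>' ^ N = 1"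
      "y = ?f (ord_t ((turn \<gamma> c oo fps_X ^ N) - (turn \<delta>' \<psi> oo fps_X ^ n)))"
      by (auto simp: contact_set_def)
    have "{z. z ^ e j = \<delta>'} \<noteq> {}"
      using card_nth_roots[of \<delta>' "e j"] root_of_unity_nonzero[OF N0 *(2)] e0 by fastforce
    then obtain \<delta> where \<delta>: "\<delta> ^ e j = \<delta>'" by auto
    then have \<delta>n: "\<delta> ^ n = 1" using *(2) by (metis nN mult.commute power_mult)
    have "y = ?f (enat N * ord_t (turn (\<gamma> / \<delta>) c - \<eta>))" using *(3) elt[OF \<delta>n] \<delta> by simp
    also have "\<dots> \<le> ?f (enat N * ord_t (c - \<eta>))"
    proof (rule ereal_divide_right_mono)
      show "ereal_of_enat (enat N * ord_t (turn (\<gamma> / \<delta>) c - \<eta>)) \<le> ereal_of_enat (enat N * ord_t (c - \<eta>))"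
        using le[of "\<gamma> / \<delta>"] *(1) \<delta>n by (simp add: power_divide mult_left_mono)
    qed (use n N0 in simp)
    finally show "y \<le> ?f (enat N * ord_t (c - \<eta>))" .
  qed
  also have "\<dots> = ereal_of_enat (ord_t (c - \<eta>)) / ereal (real n)"
    using n N0 by (cases "ord_t (c - \<eta>)") (auto simp: zero_enat_def)
  finally show ?thesis by (simp add: contact_param_eq[OF n N0])
qed

end

context close_curve
begin

lemma value_of_separatrix_form:
  assumes S0: "S 0 = [:conv_X:]" and ij: "i < J"
    and H1: "H1 \<noteq> 0" "degree H1 < n div e J" and H2: "degree H2 < n div e J"
    and less: "int_mult n c H1 + enat (v i) + enat (v J) < int_mult n c H2"
    and sep: "pullback (H1 *\<^sub>f omega_form n c S i J + dform H2) n \<eta> = 0"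
  shows "form_value n c (H1 *\<^sub>f omega_form n c S i J + dform H2)
    = int_mult n c H1 + enat (v i) + enat (v J) + enat (K - \<beta> J)"
proof -
  obtain J' where J': "J = Suc J'" using ij by (cases J) auto
  have J'g: "J' < g" using J J' by simp
  let ?a = "\<lambda>x. eval_param (S i) n x" and ?b = "\<lambda>x. eval_param (S J) n x"
  let ?h = "\<lambda>x. eval_param H1 n x" and ?r = "\<lambda>x. eval_param H2 n x"
  define d where "d = K - \<beta> J"
  have d: "d > 0" using K by (simp add: d_def)
  have pb: "pullback (H1 *\<^sub>f omega_form n c S i J + dform H2) n x
      = ?h x * (of_nat (v i) * ?a x * fps_deriv (?b x) - of_nat (v J) * ?b x * fps_deriv (?a x)) + fps_deriv (?r x)"
    for x by (simp add: pullback_add pullback_scale pullback_dform pullback_omega_form n)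
  have a: "?a c \<noteq> 0 \<and> subdegree (?a c) = v i \<and> rel_close (Suc d) (?a c) (?a \<eta>)"
  proof (cases i)
    case 0
    have "?a x = fps_X ^ n" for x
      using n by (simp add: 0 S0 eval_param_pCons conv_X.rep_eq) (simp add: eval_param_def)
    then show ?thesis using 0 by (simp add: rel_close_refl fps_X_power_subdegree)
  next
    case (Suc k)
    have k: "k < g" "k < J" using Suc ij J by auto
    obtain \<epsilon> where \<epsilon>: "?a \<eta> = ?a c * (1 + \<epsilon>)" "\<epsilon> \<noteq> 0" "subdegree \<epsilon> = K - \<beta> (Suc k)"
      using semiroot_quotient[OF k(2)] Suc by metis
    have "\<beta> (Suc k) < \<beta> J" using \<beta>_less ij J Suc by simp
    then have "Suc d \<le> subdegree \<epsilon>" using \<epsilon>(3) K by (simp add: d_def)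
    then have "rel_close (Suc d) (?a c) (?a \<eta>)"
      using \<epsilon> unfolding rel_close_def fps_X_power_dvd_iff by blast
    then show ?thesis using eval_S_c_nonzero[OF k(1)] subdegree_eval_S_c[OF k(1)] Suc by simp
  qed
  have b: "?b c \<noteq> 0" "subdegree (?b c) = v J"
    using eval_S_c_nonzero[OF J'g] subdegree_eval_S_c[OF J'g] J' by auto
  obtain \<mu> where \<mu>: "?b \<eta> = ?b c * (1 + \<mu>)" "\<mu> \<noteq> 0" "subdegree \<mu> = d"
    using semiroot_quotient[of J'] J' unfolding d_def by auto
  have h: "?h c \<noteq> 0" "rel_close d (?h c) (?h \<eta>)"
    using small_degree[of J H1] H1 by (auto simp: d_def)
  have r: "rel_close d (?r c) (?r \<eta>)"
  proof (cases "H2 = 0")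
    case True
    then show ?thesis by (simp add: eval_param_def rel_close_refl)
  next
    case False
    then show ?thesis using small_degree[of J H2] H2 by (auto simp: d_def)
  qed
  have r_sub: "?r c = 0 \<or> subdegree (?h c) + subdegree (?a c) + subdegree (?b c) < subdegree (?r c)"
    using less h(1) a b by (auto simp: int_mult_def ord_t_def split: if_splits)
  have "v i > 0" using v_pos ij J by simp
  then have "pullback (H1 *\<^sub>f omega_form n c S i J + dform H2) n c \<noteq> 0 \<and>
    Suc (subdegree (pullback (H1 *\<^sub>f omega_form n c S i J + dform H2) n c))
      = subdegree (?h c) + v i + v J + d"
    using subdegree_pullback_of_close_separatrix[of "?a c" "?b c" "?h c" d "?a \<eta>" "?b \<eta>" \<mu> "?h \<eta>" "?r c" "?r \<eta>"]
      a b h r r_sub d \<mu> sep unfolding pb by auto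
  then show ?thesis
    using h(1) by (simp add: form_value_def int_mult_def ord_t_def d_def one_enat_def)
qed

end


section \<open>Contact with the special separatrix\<close>

lemma sum_compress_nth:
  fixes c :: "complex fps"
  assumes e: "e > 0" and dvd: "\<And>l. l < b \<Longrightarrow> c $ l \<noteq> 0 \<Longrightarrow> e dvd l"
    and zero: "\<And>l. l < a \<Longrightarrow> c $ l = 0"
  shows "(\<Sum>l = a..<b. fps_const (c $ l) * fps_X ^ (l div e)) $ k = (if k * e < b then c $ (k * e) else 0)"
proof -
  have nth: "(fps_const z * fps_X ^ m :: complex fps) $ k = (if k = m then z else 0)" for z m
    by (simp add: fps_X_power_nth)
  have "(\<Sum>l = a..<b. fps_const (c $ l) * fps_X ^ (l div e)) $ k
      = (\<Sum>l = a..<b. if k = l div e then c $ l else 0)"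
    by (simp only: fps_sum_nth nth)
  also have "\<dots> = (\<Sum>l\<in>{..<b}. if l = k * e then c $ l else 0)"
  proof (rule sum.mono_neutral_cong_left)
    show "\<forall>l\<in>{..<b} - {a..<b}. (if l = k * e then c $ l else 0) = 0"
      using zero by auto
    fix l assume l: "l \<in> {a..<b}"
    show "(if k = l div e then c $ l else 0) = (if l = k * e then c $ l else 0)"
    proof (cases "c $ l = 0")
      case False
      then obtain t where "l = e * t" using dvd[of l] l by (auto elim: dvdE)
      then have "l div e = t" "l = k * e \<longleftrightarrow> t = k" using e by auto
      then show ?thesis by auto
    qed auto
  qed auto
  also have "\<dots> = (if k * e < b then c $ (k * e) else 0)" by simp
  finally show ?thesis .
qed

context puiseux_branch
begin

lemma psi_nth:
  assumes j: "0 < j" "j \<le> g"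
  shows "psi n c j s u $ k =
    (if k * e j < \<beta> j then c $ (k * e j) else if k * e j = \<beta> j then u else s k u)"
proof -
  obtain B where B: "\<beta> j = e j * B" using e_dvd_\<beta>[of j j] by (auto elim: dvdE)
  have e: "e j > 0" by (rule e_pos)
  have div: "\<beta> j div e j = B" using e by (simp add: B)
  have iff: "k * e j < \<beta> j \<longleftrightarrow> k < B" "k * e j = \<beta> j \<longleftrightarrow> k = B"
    unfolding B using e by (auto simp: mult.commute)
  have "(\<Sum>l = \<beta> 1..<\<beta> j. fps_const (c $ l) * fps_X ^ (l div e j)) $ k
      = (if k * e j < \<beta> j then c $ (k * e j) else 0)"
    using c_below[of j _ j] j by (intro sum_compress_nth e \<beta>_1(2)) auto
  then show ?thesis
    unfolding psi_def Let_def div fps_add_nth iff by (simp add: fps_X_power_nth)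
qed

lemma trunc_eq_sum: "(\<Sum>k = \<beta> 1..<\<beta> i. fps_const (c $ k) * fps_X ^ k) = trunc i"
proof (rule fps_ext)
  fix k
  show "(\<Sum>k = \<beta> 1..<\<beta> i. fps_const (c $ k) * fps_X ^ k) $ k = trunc i $ k"
    using sum_compress_nth[of 1 "\<beta> i" c "\<beta> 1" k] \<beta>_1(2) by simp
qed

end


theorem theorem4p4:
  fixes F H1 H2 Fstar :: "conv_fps poly"
    and S :: "nat \<Rightarrow> conv_fps poly"
    and n i j :: nat
    and c :: "complex fps"
    and s :: "nat \<Rightarrow> complex \<Rightarrow> complex"
    and \<omega> :: form
  assumes branch: "normalized_branch F n c"
    and semiroots: "canonical_semiroots F n c S"
    and ij: "i < j" "j \<le> genus n c"
    and omega: "\<omega> = H1 *\<^sub>f omega_form n c S i j + dform H2"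
    and degs: "degree H1 < degree (S (j + 1))" "degree H2 < degree (S (j + 1))"
    and H1: "H1 \<noteq> 0"
    and H2: "of_conv_poly H2 \<in> max_ideal2"
    and mult_less: "int_mult n c H1 + enat (sg_gen n c i) + enat (sg_gen n c j) < int_mult n c H2"
    and foliation: "defines_foliation \<omega>"
    and family: "separatrix_family \<omega> n c j s"
    and Fstar: "irreducible Fstar" "weierstrass_poly Fstar"
      "eval_param Fstar (n div char_gcd n c j) (psi n c j s (c $ char_exp n c j)) = 0"
  shows "contact F Fstar =
    (ereal_of_enat (form_value n c \<omega>) - ereal_of_enat (int_mult n c H1)
      - ereal (real (sg_gen n c i)) - ereal (real (sg_gen n c j)) + ereal (real (char_exp n c j)))
    / ereal (real (sg_gen n c 0))"
proof -
  have F: "degree F = n" "puiseux_param F n c" and n1: "n > 1"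
    and norm: "\<exists>b>n. \<not> n dvd b \<and> c $ b \<noteq> 0 \<and> (\<forall>k<b. c $ k = 0)"
    using branch by (auto simp: normalized_branch_def)
  interpret puiseux_branch n c
    using F(2) norm by unfold_locales (auto simp: puiseux_param_def)
  have S: "S 0 = [:conv_X:]" "S (g + 1) = F"
    and minS: "\<And>i. i \<in> {1..g} \<Longrightarrow> is_min_poly (S i) n (trunc i)"
    using semiroots unfolding canonical_semiroots_def trunc_eq_sum by blast+
  interpret branch_with_semiroots n c S
    using minS by unfold_locales simp
  define N where "N = n div e j"
  define \<psi> where "\<psi> = psi n c j s (c $ \<beta> j)"
  define \<eta> where "\<eta> = \<psi> oo fps_X ^ e j"
  have j: "0 < j" "j \<le> g" using ij by auto
  have nN: "n = N * e j" using e_dvd_n[of j] by (simp add: N_def)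
  have N: "N > 0" using n e_dvd_n[of j] e_pos[of j] by (simp add: N_def div_greater_zero_iff dvd_imp_le)
  have deg_S: "degree (S (j + 1)) = N"
  proof (cases "j = g")
    case True
    then show ?thesis using S(2) F(1) e_genus by (simp add: N_def)
  next
    case False
    then show ?thesis using degree_S[of j] j by (simp add: N_def)
  qed
  have c_bj: "c $ \<beta> j \<noteq> 0" using c_\<beta> j by simp
  then have \<psi>_conv: "fps_conv_radius \<psi> > 0" and sep\<psi>: "pullback \<omega> N \<psi> = 0"
    using family by (auto simp: separatrix_family_def \<psi>_def N_def)
  have sep: "pullback \<omega> n \<eta> = 0"
    using pullback_compose_X_power[OF N e_pos, of \<omega> j \<psi>] unfolding sep\<psi> \<eta>_def nN[symmetric] by simp
  have \<psi>_nth: "\<psi> $ k = c $ (k * e j)" if "k * e j \<le> \<beta> j" for k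
    using that psi_nth[OF j, of s "c $ \<beta> j" k] by (auto simp: \<psi>_def)
  have agree: "\<eta> $ l = c $ l" if l: "l \<le> \<beta> j" for l
  proof (cases "e j dvd l")
    case True
    then have "l div e j * e j = l" by simp
    then show ?thesis
      using \<psi>_nth[of "l div e j"] l True e_pos[of j] by (simp add: \<eta>_def fps_nth_compose_X_power)
  next
    case False
    then have "l \<noteq> \<beta> j" using e_dvd_\<beta>[of j j] by auto
    then have "c $ l = 0" using c_below[of j l j] False j l by auto
    then show ?thesis using False e_pos[of j] by (simp add: \<eta>_def fps_nth_compose_X_power)
  qed
  \<comment> \<open>\<open>\<psi>\<close> contains the exponents \<open>\<beta>_i/e_j\<close> for \<open>i \<le> j\<close>, the last one because its coefficient \<open>c_(\<beta>_j)\<close> is not zero.\<close>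
  have "Gcd (insert N {k. \<psi> $ k \<noteq> 0}) = 1"
  proof -
    let ?x = "Gcd (insert N {k. \<psi> $ k \<noteq> 0})"
    have "?x * e j dvd e j"
    proof (rule dvd_e)
      have "?x dvd N" by (rule Gcd_dvd) simp
      then have "?x * e j dvd N * e j" by (intro mult_dvd_mono) auto
      then show "?x * e j dvd n" using nN by metis
      fix i assume i: "1 \<le> i" "i \<le> j"
      have "e j dvd \<beta> i" using e_dvd_\<beta> i by simp
      then have b: "\<beta> i div e j * e j = \<beta> i" by simp
      have "\<beta> i \<le> \<beta> j" using \<beta>_le i j by simp
      then have "\<psi> $ (\<beta> i div e j) = c $ \<beta> i" using \<psi>_nth[of "\<beta> i div e j"] b by simp
      then have "\<psi> $ (\<beta> i div e j) \<noteq> 0" using c_\<beta>[of i] i j by simp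
      then have "?x dvd \<beta> i div e j" by (intro Gcd_dvd) simp
      then have "?x * e j dvd \<beta> i div e j * e j" by (intro mult_dvd_mono) auto
      then show "?x * e j dvd \<beta> i" using b by metis
    qed
    then have "?x * e j dvd 1 * e j" by simp
    then have "?x dvd 1" using e_pos[of j] by (simp only: dvd_times_right_cancel_iff neq0_conv)
    then show ?thesis by simp
  qed
  moreover have "\<psi> $ 0 = 0"
    using \<psi>_nth[of 0] F(2) by (simp add: puiseux_param_def)
  moreover have ev: "eval_param Fstar N \<psi> = 0" using Fstar(3) by (simp add: N_def \<psi>_def)
  ultimately have Fstar_param: "puiseux_param Fstar N \<psi>"
    using N \<psi>_conv by (simp add: puiseux_param_def)
  then have "degree Fstar = N"
    using degree_irreducible_param[OF Fstar(1) N \<psi>_conv _ ev] by (simp add: puiseux_param_def)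
  then have contact: "contact F Fstar = ereal_of_enat (ord_t (c - \<eta>)) / ereal (real n)"
    using contact_eq[OF F(2,1) Fstar_param] contact_param_value[OF j(2) N_def \<eta>_def agree] by simp
  obtain h where h: "int_mult n c H1 = enat h"
    using mult_less by (cases "int_mult n c H1") auto
  show ?thesis
  proof (cases "\<eta> = c")
    case True
    then have "form_value n c \<omega> = \<infinity>" using sep by (simp add: form_value_def ord_t_def)
    then show ?thesis using True n by (simp add: contact h ord_t_def)
  next
    case False
    define K where "K = subdegree (\<eta> - c)"
    have ord: "ord_t (c - \<eta>) = enat K"
      using False by (auto simp: ord_t_def K_def)
    have "enat (\<beta> j) < ord_t (c - \<eta>)" using agree by (simp add: ord_t_greater_iff)
    then have K: "\<beta> j < K" by (simp add: ord)
    interpret close_curve n c S \<eta> j K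
      using j False K by unfold_locales (auto simp: K_def)
    have "form_value n c \<omega> = int_mult n c H1 + enat (v i) + enat (v j) + enat (K - \<beta> j)"
      using value_of_separatrix_form[OF S(1) ij(1) H1 _ _ mult_less] sep degs
      unfolding omega deg_S N_def by simp
    then have "form_value n c \<omega> = enat (h + v i + v j + (K - \<beta> j))" by (simp add: h)
    then show ?thesis using K n by (simp add: contact h ord of_nat_diff)
  qed
qed

end
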